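(* An ABC voting rule $f$ (for fixed $m\ge 2$ and fixed committee size $k\in\{1,\dots,m-1\}$) is a Thiele rule if and only if it satisfies anonymity, neutrality, consistency, continuity, and independence of losers.
   Context: Let $\mathcal C=\{c_1,\dots,c_m\}$ be a set of $m\ge 2$ candidates and $\mathbb N=\{1,2,\dots\}$ the set of potential voters. An electorate is a non-empty finite $N\subseteq\mathbb N$. An approval ballot is a non-empty subset of $\mathcal C$; $\mathcal A$ is the set of all ballots. A profile is a map $A:N\to\mathcal A$ for some electorate $N=N_A$, with $A_i$ the ballot of voter $i$; $\mathcal A^*$ is the set of all profiles. Profiles $A,A'$ are disjoint if $N_A\cap N_{A'}=\emptyset$, and then $A+A'$ is the profile on $N_A\cup N_{A'}$ agreeing with $A$ on $N_A$ and with $A'$ on $N_{A'}$. For $\lambda\in\mathbb N$, $\lambda A$ denotes a profile consisting of $\lambda$ copies of $A$ on pairwise disjoint voter sets. Fix $k\in\{1,\dots,m-1\}$; $\mathcal W_k=\{W\subseteq\mathcal C:|W|=k\}$ is the set of committees. An ABC voting rule is a map $f:\mathcal A^*\to 2^{\mathcal W_k}\setminus\{\emptyset\}$. Axioms: $f$ is anonymous if $f(A)=f(\pi(A))$ for all $A$ and permutations $\pi$ of $\mathbb N$, where $\pi(A)$ has electorate $\pi(N_A)$ and $\pi(A)_{\pi(i)}=A_i$. $f$ is neutral if $f(\tau(A))=\{\tau(W):W\in f(A)\}$ for all $A$ and permutations $\tau$ of $\mathcal C$, where $\tau(A)_i=\tau(A_i)$. $f$ is consistent if $f(A+A')=f(A)\cap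 f(A')$ for all disjoint $A,A'$ with $f(A)\cap f(A')\neq\emptyset$. $f$ is continuous if for all profiles $A,A'$ there is $\lambda\in\mathbb N$ with $f(\lambda A+A')\subseteq f(A)$. $f$ is independent of losers if $W\in f(A)$ implies $W\in f(A')$ for all profiles $A,A'$ with $N_A=N_{A'}$ and committees $W$ such that $A'_i\subseteq A_i$ and $W\cap A'_i=W\cap A_i$ for all $i\in N_A$. A Thiele scoring function is a non-decreasing $s:\{0,\dots,k\}\to\mathbb R$ with $s(0)=0$. $f$ is a Thiele rule if there is a Thiele scoring function $s$ with $f(A)=\{W\in\mathcal W_k:\hat s(A,W)\ge\hat s(A,W')\ \forall W'\in\mathcal W_k\}$ for all $A$, where $\hat s(A,W)=\sum_{i\in N_A}s(|A_i\cap W|)$. *)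

theory Defs
  imports Complex_Main
begin

text \<open>Candidates: a finite type 'c (m = CARD('c)). Voters: positive naturals.
 A profile is a function A :: nat \<Rightarrow> 'c set whose electorate is the set of voters
 with a non-empty ballot; voters outside the electorate get the empty set.\<close>

type_synonym 'c profile = "nat \<Rightarrow> 'c set"

definition electorate :: "'c profile \<Rightarrow> nat set" where
  "electorate A = {i. A i \<noteq> {}}"

definition is_profile :: "'c profile \<Rightarrow> bool" where
  "is_profile A \<longleftrightarrow> finite (electorate A) \<and> electorate A \<noteq> {} \<and> 0 \<notin> electorate A"

definition committees :: "nat \<Rightarrow> 'c set set" where
  "committees k = {W. card W = k}"

definition abc_rule :: "nat \<Rightarrow> ('c::finite profile \<Rightarrow> 'c set set) \<Rightarrow> bool" where
  "abc_rule k f \<longleftrightarrow> (\<forall>A. is_profile A \<longrightarrow> f A \<noteq> {} \<and> f A \<subseteq> committees k)"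

definition disjoint_profiles :: "'c profile \<Rightarrow> 'c profile \<Rightarrow> bool" where
  "disjoint_profiles A B \<longleftrightarrow> electorate A \<inter> electorate B = {}"

definition add_profiles :: "'c profile \<Rightarrow> 'c profile \<Rightarrow> 'c profile" where
  "add_profiles A B = (\<lambda>i. A i \<union> B i)"

definition copies_of :: "nat \<Rightarrow> 'c profile \<Rightarrow> 'c profile \<Rightarrow> bool" where
  "copies_of lam A B \<longleftrightarrow> (\<exists>g :: nat \<Rightarrow> nat \<Rightarrow> nat.
      (\<forall>j<lam. inj_on (g j) (electorate A)) \<and>
      (\<forall>j<lam. \<forall>j'<lam. j \<noteq> j' \<longrightarrow> g j ` electorate A \<inter> g j' ` electorate A = {}) \<and>
      electorate B = (\<Union>j<lam. g j ` electorate A) \<and>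
      (\<forall>j<lam. \<forall>i\<in>electorate A. B (g j i) = A i))"

definition anonymous :: "('c profile \<Rightarrow> 'c set set) \<Rightarrow> bool" where
  "anonymous f \<longleftrightarrow> (\<forall>A \<pi>. is_profile A \<longrightarrow> bij \<pi> \<longrightarrow> \<pi> 0 = (0::nat) \<longrightarrow>
      f A = f (A \<circ> inv \<pi>))"

definition neutral :: "('c profile \<Rightarrow> 'c set set) \<Rightarrow> bool" where
  "neutral f \<longleftrightarrow> (\<forall>A (\<tau>::'c \<Rightarrow> 'c). is_profile A \<longrightarrow> bij \<tau> \<longrightarrow>
      f (\<lambda>i. \<tau> ` A i) = (\<lambda>W. \<tau> ` W) ` f A)"

definition consistent :: "('c profile \<Rightarrow> 'c set set) \<Rightarrow> bool" where
  "consistent f \<longleftrightarrow> (\<forall>A B. is_profile A \<longrightarrow> is_profile B \<longrightarrow> disjoint_profiles A B \<longrightarrow>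
      f A \<inter> f B \<noteq> {} \<longrightarrow> f (add_profiles A B) = f A \<inter> f B)"

definition continuous_rule :: "('c profile \<Rightarrow> 'c set set) \<Rightarrow> bool" where
  "continuous_rule f \<longleftrightarrow> (\<forall>A A'. is_profile A \<longrightarrow> is_profile A' \<longrightarrow>
      (\<exists>lam\<ge>1. \<forall>B. is_profile B \<longrightarrow> copies_of lam A B \<longrightarrow> disjoint_profiles B A' \<longrightarrow>
         f (add_profiles B A') \<subseteq> f A))"

definition indep_losers :: "('c profile \<Rightarrow> 'c set set) \<Rightarrow> bool" where
  "indep_losers f \<longleftrightarrow> (\<forall>A A' W. is_profile A \<longrightarrow> is_profile A' \<longrightarrow>
      electorate A = electorate A' \<longrightarrow>
      (\<forall>i\<in>electorate A. A' i \<subseteq> A i \<and> W \<inter> A' i = W \<inter> A i) \<longrightarrow>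
      W \<in> f A \<longrightarrow> W \<in> f A')"

definition thiele_score :: "(nat \<Rightarrow> real) \<Rightarrow> 'c profile \<Rightarrow> 'c set \<Rightarrow> real" where
  "thiele_score s A W = (\<Sum>i\<in>electorate A. s (card (A i \<inter> W)))"

definition thiele_rule :: "nat \<Rightarrow> ('c::finite profile \<Rightarrow> 'c set set) \<Rightarrow> bool" where
  "thiele_rule k f \<longleftrightarrow> (\<exists>s :: nat \<Rightarrow> real. s 0 = 0 \<and>
      (\<forall>i j. i \<le> j \<longrightarrow> j \<le> k \<longrightarrow> s i \<le> s j) \<and>
      (\<forall>A. is_profile A \<longrightarrow> f A = {W \<in> committees k.
          \<forall>W'\<in>committees k. thiele_score s A W \<ge> thiele_score s A W'}))"

end

theory Submission
  imports Defs "HOL-Library.Function_Algebras" "HOL-Combinatorics.Permutations"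
begin

text \<open>
  Anonymity, consistency and the fact that every committee wins when all ballots occur equally often
  turn the rule into a map \<open>F\<close> on integer vectors indexed by ballots, with \<open>F v \<inter> F w = F (v + w)\<close>
  whenever the intersection is nonempty.

  If \<open>F\<close> is not constant, then independence of losers yields vectors for which exactly the
  committees containing (or avoiding) a given candidate win, so that adding a large multiple of a sum of
  such vectors confines the winners to any interval \<open>{X. C \<subseteq> X \<subseteq> U}\<close>. For two committees
  \<open>C \<union> {a}\<close> and \<open>C \<union> {b}\<close> the vectors preferring the first form, after
  confinement, a total Archimedean cone, and Hoelder's theorem represents it by an additive functional.
  Symmetry and independence of losers force this functional to be a difference of Thiele scores. So a winning
  committee has maximal score among its neighbours.

  For committees \<open>V\<close>, \<open>W\<close> further apart, suppose that \<open>V\<close> wins at \<open>v\<close> with a smaller score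
  than \<open>W\<close>. If the scoring function is affine, exchanging one candidate gives a contradiction. Otherwise there is
  a vector \<open>r\<close>, invariant under an involution \<open>\<sigma>\<close> swapping \<open>V\<close> and \<open>W\<close>, whose score is maximal at
  both \<open>V\<close> and \<open>W\<close> but not at all committees between them. For a suitable rational \<open>q\<close>, the best
  intermediate score at \<open>v - q r\<close> lies strictly between those of \<open>V\<close> and \<open>W\<close>, so by induction
  only \<open>W\<close> wins there. Adding the \<open>\<sigma>\<close>-image of this vector to \<open>v\<close> gives a
  \<open>\<sigma>\<close>-invariant vector at which only \<open>V\<close> wins, which is absurd.
\<close>

section \<open>Archimedean cones\<close>

text \<open>A form of Hoelder's theorem. Call \<open>x\<close> below \<open>y\<close> if
  \<open>P (y - x)\<close>. If some \<open>- z\<close> lies outside \<open>P\<close>, then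
  \<open>z\<close> serves as a unit, and \<open>u x\<close> is the supremum of the fractions m/n for
  which \<open>m z\<close> lies below \<open>n x\<close>. Approximating \<open>x\<close> and
  \<open>y\<close> by fractions of the same denominator N gives additivity up to an error 2/N, for
  every N. If \<open>P\<close> holds everywhere, the zero functional does it.\<close>

lemma archimedean_cone_functional:
  fixes P :: "'a::comm_ring_1 \<Rightarrow> bool"
  assumes add: "\<And>x y. P x \<Longrightarrow> P y \<Longrightarrow> P (x + y)"
    and total: "\<And>x. P x \<or> P (- x)"
    and arch: "\<And>x z. \<not> P (- z) \<Longrightarrow> \<exists>n. P (of_nat n * z - x)"
  obtains u :: "'a \<Rightarrow> real" where "\<And>x y. u (x + y) = u x + u y" and "\<And>x. P x \<longleftrightarrow> 0 \<le> u x"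
proof (cases "\<forall>x. P x")
  case True
  show ?thesis by (rule that[of "\<lambda>_. 0"]) (use True in auto)
next
  case False
  then obtain z where nz: "\<not> P (- z)" by (metis minus_minus)
  have P0: "P 0" using total[of 0] by simp
  have Pnat: "P (of_nat n * x)" if "P x" for n x
    by (induction n) (use that P0 add in \<open>auto simp: algebra_simps\<close>)
  \<comment> \<open>The unit is strictly positive: adding \<open>j\<close> copies of
    \<open>z\<close> to \<open>-(j + 1) z\<close> would put \<open>- z\<close> into the
    cone.\<close>
  have Pz: "0 \<le> m" if "P (of_int m * z)" for m
  proof (rule ccontr)
    assume "\<not> 0 \<le> m"
    then obtain j where j: "m = - int (Suc j)" by (metis not_le int_cases of_nat_0_le_iff)
    have "P (of_nat j * z)" using total[of z] nz by (intro Pnat) auto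
    then have "P (of_int m * z + of_nat j * z)" using that by (intro add)
    then show False using nz by (simp add: j algebra_simps)
  qed
  define L where "L x = {real_of_int m / real n | m n. 0 < n \<and> P (of_nat n * x - of_int m * z)}" for x
  define u where "u x = Sup (L x)" for x
  have upper: "q \<le> real_of_int m / real n"
    if h: "P (of_int m * z - of_nat n * x)" "0 < n" "q \<in> L x" for m n x q
  proof -
    obtain m' n' where q: "q = real_of_int m' / real n'" "0 < n'" "P (of_nat n' * x - of_int m' * z)"
      using h(3) unfolding L_def by blast
    have "P (of_nat n * (of_nat n' * x - of_int m' * z) + of_nat n' * (of_int m * z - of_nat n * x))"
      using h q by (intro add Pnat)
    also have "of_nat n * (of_nat n' * x - of_int m' * z) + of_nat n' * (of_int m * z - of_nat n * x)
      = of_int (int n' * m - int n * m') * z"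
      by (simp add: algebra_simps)
    finally have "int n * m' \<le> int n' * m" using Pz by fastforce
    then have "real n * real_of_int m' \<le> real n' * real_of_int m"
      by (metis of_int_le_iff of_int_mult of_int_of_nat_eq)
    then show ?thesis using h(2) q(2) unfolding q(1) by (simp add: field_simps)
  qed
  have ne: "L x \<noteq> {}" for x
  proof -
    obtain n where "P (of_nat n * z - (- x))" using arch[OF nz] by blast
    then have "P (of_nat 1 * x - of_int (- int n) * z)" by (simp add: add.commute)
    then show ?thesis unfolding L_def by blast
  qed
  have bdd: "bdd_above (L x)" for x
  proof -
    obtain n where "P (of_nat n * z - x)" using arch[OF nz] by blast
    then have "P (of_int (int n) * z - of_nat 1 * x)" by simp
    from upper[OF this] show ?thesis by (intro bdd_aboveI) auto
  qed
  have u_ge: "real_of_int m / real n \<le> u x" if "P (of_nat n * x - of_int m * z)" "0 < n" for m n x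
    unfolding u_def by (rule cSup_upper[OF _ bdd]) (use that in \<open>auto simp: L_def\<close>)
  have u_le: "u x \<le> real_of_int m / real n" if "P (of_int m * z - of_nat n * x)" "0 < n" for m n x
    unfolding u_def using ne upper[OF that] by (intro cSup_least) auto
  have P_lt: "P (of_nat n * x - of_int m * z)" if "real_of_int m < real n * u x" "0 < n" for m n x
  proof (rule ccontr)
    assume "\<not> ?thesis"
    then have "P (of_int m * z - of_nat n * x)" using total[of "of_nat n * x - of_int m * z"] by simp
    from u_le[OF this] that show False by (simp add: field_simps)
  qed
  have P_gt: "P (of_int m * z - of_nat n * x)" if "real n * u x < real_of_int m" "0 < n" for m n x
  proof (rule ccontr)
    assume "\<not> ?thesis"
    then have "P (of_nat n * x - of_int m * z)" using total[of "of_nat n * x - of_int m * z"] by simp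
    from u_ge[OF this] that show False by (simp add: field_simps)
  qed
  have close: "\<bar>u (x + y) - (u x + u y)\<bar> \<le> 2 / real (Suc n)" for x y n
  proof -
    let ?N = "Suc n"
    \<comment> \<open>\<open>P_lt\<close> and \<open>P_gt\<close> need strict bounds. So
      \<open>a\<close> and \<open>b\<close> are the largest integers strictly below the scaled
      values, \<open>c\<close> and \<open>d\<close> the smallest ones strictly above.\<close>
    define a b c d where abcd: "a = \<lceil>real ?N * u x\<rceil> - 1" "b = \<lceil>real ?N * u y\<rceil> - 1"
      "c = \<lfloor>real ?N * u x\<rfloor> + 1" "d = \<lfloor>real ?N * u y\<rfloor> + 1"
    have ab: "real_of_int a < real ?N * u x" "real_of_int b < real ?N * u y"
      "real ?N * u x - 1 \<le> real_of_int a" "real ?N * u y - 1 \<le> real_of_int b"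
      and cd: "real ?N * u x < real_of_int c" "real ?N * u y < real_of_int d"
      "real_of_int c \<le> real ?N * u x + 1" "real_of_int d \<le> real ?N * u y + 1"
      unfolding abcd by linarith+
    have "P ((of_nat ?N * x - of_int a * z) + (of_nat ?N * y - of_int b * z))"
      using ab by (intro add P_lt) auto
    also have "(of_nat ?N * x - of_int a * z) + (of_nat ?N * y - of_int b * z)
      = of_nat ?N * (x + y) - of_int (a + b) * z" by (simp add: algebra_simps)
    finally have "real_of_int (a + b) / real ?N \<le> u (x + y)" by (rule u_ge) simp
    then have lo: "real_of_int (a + b) \<le> real ?N * u (x + y)" by (simp add: field_simps)
    have "P ((of_int c * z - of_nat ?N * x) + (of_int d * z - of_nat ?N * y))"
      using cd by (intro add P_gt) auto
    also have "(of_int c * z - of_nat ?N * x) + (of_int d * z - of_nat ?N * y)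
      = of_int (c + d) * z - of_nat ?N * (x + y)" by (simp add: algebra_simps)
    finally have "u (x + y) \<le> real_of_int (c + d) / real ?N" by (rule u_le) simp
    then have hi: "real ?N * u (x + y) \<le> real_of_int (c + d)" by (simp add: field_simps)
    have "\<bar>real ?N * (u (x + y) - (u x + u y))\<bar> \<le> 2"
      using lo hi ab cd unfolding right_diff_distrib distrib_left of_int_add by linarith
    then have "real ?N * \<bar>u (x + y) - (u x + u y)\<bar> \<le> 2" by (simp add: abs_mult)
    then show ?thesis by (simp add: field_simps)
  qed
  show ?thesis
  proof (rule that[of u])
    fix x y
    have "(\<lambda>n. 2 / real (Suc n)) \<longlonglongrightarrow> 0" 
      using LIMSEQ_Suc[OF lim_const_over_n[of "2::real"]] by simp
    then have "\<bar>u (x + y) - (u x + u y)\<bar> \<le> 0"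
      using close[of x y] by (intro LIMSEQ_le_const) auto
    then show "u (x + y) = u x + u y" by simp
  next
    fix x
    show "P x \<longleftrightarrow> 0 \<le> u x"
    proof
      assume "P x"
      with u_ge[of 1 x 0] show "0 \<le> u x" by simp
    next
      assume u0: "0 \<le> u x"
      show "P x"
      proof (rule ccontr)
        assume "\<not> P x"
        \<comment> \<open>Here \<open>n x\<close> lies below \<open>- z\<close>, which forces
          \<open>u x\<close> to be at most -1/n. The case \<open>n = 0\<close> would put
          \<open>- z\<close> into the cone.\<close>
        then obtain n where n: "P (of_nat n * (- x) - z)" using arch[of "- x" z] by auto
        then have "n \<noteq> 0" using nz by (intro notI) simp
        moreover have "of_nat n * (- x) - z = of_int (-1) * z - of_nat n * x" by simp
        from n[unfolded this] have "P (of_int (-1) * z - of_nat n * x)" .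
        ultimately have "u x \<le> real_of_int (-1) / real n" by (intro u_le) auto
        moreover have "real_of_int (-1) / real n < 0" using \<open>n \<noteq> 0\<close> by simp
        ultimately show False using u0 by linarith
      qed
    qed
  qed
qed

text \<open>Raise the slope \<open>l\<close> in \<open>h X + l * \<rho> X\<close> from 0. Up to
  \<open>l0\<close> no value is positive, and just above \<open>l0\<close> one becomes positive,
  while all of them stay below \<open>D\<close> as long as \<open>l < l0 + D / M\<close>. A rational
  slope m/n in this window, with denominators cleared, gives the claim. It serves to move the best
  score of the intermediate committees strictly between those of two distant committees.\<close>

lemma rational_crossing:
  fixes h \<rho> :: "'x \<Rightarrow> real"
  assumes fin: "finite I" and h: "\<And>X. X \<in> I \<Longrightarrow> h X \<le> 0" and \<rho>: "\<And>X. X \<in> I \<Longrightarrow> 0 \<le> \<rho> X"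
    and X0: "X0 \<in> I" "0 < \<rho> X0" and D: "0 < D"
  obtains n m :: nat where "1 \<le> n" "\<exists>X\<in>I. 0 < real n * h X + real m * \<rho> X"
    "\<And>X. X \<in> I \<Longrightarrow> real n * h X + real m * \<rho> X < real n * D"
proof -
  define J where "J = {X \<in> I. 0 < \<rho> X}"
  define f where "f X = - h X / \<rho> X" for X
  define l0 where "l0 = Min (f ` J)"
  define M where "M = Max (\<rho> ` I)"
  have J: "finite J" "J \<noteq> {}" using fin X0 by (auto simp: J_def)
  have M: "\<rho> X \<le> M" if "X \<in> I" for X using that fin by (simp add: M_def)
  have M0: "0 < M" using M[OF X0(1)] X0(2) by simp
  have "l0 \<in> f ` J" unfolding l0_def using J by (intro Min_in) auto
  then obtain X1 where X1: "X1 \<in> J" "l0 = f X1" by blast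
  have "0 \<le> f X1" using h[of X1] X1(1) by (auto simp: f_def J_def intro!: divide_nonpos_pos)
  then have l0: "0 \<le> l0" using X1 by simp
  have l0_le: "h X + l0 * \<rho> X \<le> 0" if "X \<in> I" for X
  proof (cases "0 < \<rho> X")
    case True
    then have "l0 \<le> f X" unfolding l0_def using J that by (intro Min_le) (auto simp: J_def)
    then have "l0 * \<rho> X \<le> - h X" using True by (simp add: f_def field_simps)
    then show ?thesis by simp
  next
    case False
    then have "\<rho> X = 0" using \<rho>[OF that] by simp
    then show ?thesis using h[OF that] by simp
  qed
  have "l0 < l0 + D / M" using D M0 by simp
  then obtain q where q: "q \<in> \<rat>" "l0 < q" "q < l0 + D / M" using Rats_dense_in_real by blast
  have q0: "0 \<le> q" using q(2) l0 by linarith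
  then obtain m n where mn: "n \<noteq> 0" "\<bar>q\<bar> = real m / real n" using Rats_abs_nat_div_natE[OF q(1)] by metis
  then have qmn: "q = real m / real n" using q0 by simp
  have scale: "real n * h X + real m * \<rho> X = real n * (h X + q * \<rho> X)" for X
    using mn(1) by (simp add: qmn field_simps)
  show thesis
  proof (rule that[of n m])
    show "1 \<le> n" using mn(1) by simp
    have r1: "0 < \<rho> X1" "X1 \<in> I" using X1 by (auto simp: J_def)
    have "l0 * \<rho> X1 < q * \<rho> X1" using r1 q(2) by (intro mult_strict_right_mono)
    moreover have "l0 * \<rho> X1 = - h X1" using r1 X1(2) by (simp add: f_def)
    ultimately have "0 < h X1 + q * \<rho> X1" by linarith
    then have "0 < real n * h X1 + real m * \<rho> X1" unfolding scale using mn(1) by simp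
    then show "\<exists>X\<in>I. 0 < real n * h X + real m * \<rho> X" using r1 by blast
  next
    fix X assume X: "X \<in> I"
    have "(q - l0) * \<rho> X \<le> (q - l0) * M" using q(2) M[OF X] by (intro mult_left_mono) auto
    moreover have "(q - l0) * M < D" using q(3) M0 by (simp add: field_simps)
    ultimately have "h X + q * \<rho> X < D" using l0_le[OF X] by (simp add: algebra_simps)
    then show "real n * h X + real m * \<rho> X < real n * D" unfolding scale using mn(1) by simp
  qed
qed

section \<open>Permutations of the candidates\<close>

lemma bij_image_three_blocks:
  fixes A B C A' B' C' :: "'c::finite set"
  assumes "card A = card A'" "card B = card B'" "card C = card C'"
    and "A \<inter> B = {}" "A \<inter> C = {}" "B \<inter> C = {}" "A' \<inter> B' = {}" "A' \<inter> C' = {}" "B' \<inter> C' = {}"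
  obtains \<tau> where "bij \<tau>" "\<tau> ` A = A'" "\<tau> ` B = B'" "\<tau> ` C = C'"
proof -
  have "card (- (A \<union> B \<union> C)) = card (- (A' \<union> B' \<union> C'))"
    using assms by (simp add: Compl_eq_Diff_UNIV card_Diff_subset card_Un_disjoint Int_Un_distrib2)
  then obtain h where h: "bij_betw h (- (A \<union> B \<union> C)) (- (A' \<union> B' \<union> C'))"
    using finite_same_card_bij by (metis finite)
  obtain fa where fa: "bij_betw fa A A'" using finite_same_card_bij assms(1) by (metis finite)
  obtain fb where fb: "bij_betw fb B B'" using finite_same_card_bij assms(2) by (metis finite)
  obtain fc where fc: "bij_betw fc C C'" using finite_same_card_bij assms(3) by (metis finite)
  define \<tau> where "\<tau> x = (if x \<in> A then fa x else if x \<in> B then fb x else if x \<in> C then fc x else h x)" for x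
  have 1: "bij_betw \<tau> A A'" using fa by (subst bij_betw_cong[of _ _ fa]) (auto simp: \<tau>_def)
  have 2: "bij_betw \<tau> B B'" using fb assms by (subst bij_betw_cong[of _ _ fb]) (auto simp: \<tau>_def)
  have 3: "bij_betw \<tau> C C'" using fc assms by (subst bij_betw_cong[of _ _ fc]) (auto simp: \<tau>_def)
  have 4: "bij_betw \<tau> (- (A \<union> B \<union> C)) (- (A' \<union> B' \<union> C'))"
    using h by (subst bij_betw_cong[of _ _ h]) (auto simp: \<tau>_def)
  have "bij_betw \<tau> (A \<union> B \<union> C \<union> - (A \<union> B \<union> C)) (A' \<union> B' \<union> C' \<union> - (A' \<union> B' \<union> C'))"
    by (intro bij_betw_combine 1 2 3 4) (use assms in auto)
  then have "bij \<tau>" by (simp only: Compl_partition)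
  then show ?thesis using 1 2 3 by (intro that[of \<tau>]) (auto simp: bij_betw_def)
qed

lemma bij_image_card:
  fixes V V' :: "'c::finite set"
  assumes "card V = card V'"
  obtains \<tau> where "bij \<tau>" "\<tau> ` V = V'"
  by (rule bij_image_three_blocks[OF assms, of "{}" "{}" "{}" "{}"]) auto

lemma bij_image_card_fixing:
  fixes V V' :: "'c::finite set"
  assumes "card V = card V'" "x \<in> V \<longleftrightarrow> x \<in> V'"
  obtains \<tau> where "bij \<tau>" "\<tau> x = x" "\<tau> ` V = V'"
proof -
  have "card (V - {x}) = card (V' - {x})" using assms by (auto simp: card_Diff_singleton_if)
  then obtain \<tau> where t: "bij \<tau>" "\<tau> ` (V - {x}) = V' - {x}" "\<tau> ` {x} = {x}"
    by (rule bij_image_three_blocks[of _ _ "{x}" "{x}" "{}" "{}"]) auto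
  then have "\<tau> x = x" by auto
  moreover have "\<tau> ` V = V'"
  proof (cases "x \<in> V")
    case True
    then have "V = insert x (V - {x})" "V' = insert x (V' - {x})" using assms by auto
    then show ?thesis using t(2) \<open>\<tau> x = x\<close> by (metis image_insert)
  next
    case False
    then show ?thesis using t(2) assms by simp
  qed
  ultimately show ?thesis using that t(1) by blast
qed

lemma bij_image_subset_fixing_outside:
  fixes B B' C :: "'c::finite set"
  assumes "card B = card B'" "B \<subseteq> C" "B' \<subseteq> C"
  obtains \<tau> where "bij \<tau>" "\<tau> ` B = B'" "\<tau> ` C = C" "\<And>x. x \<notin> C \<Longrightarrow> \<tau> x = x"
proof -
  have "card (C - B) = card (C - B')" using assms by (simp add: card_Diff_subset)
  then obtain h where h: "bij_betw h (C - B) (C - B')" using finite_same_card_bij by (metis finite)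
  obtain f where f: "bij_betw f B B'" using finite_same_card_bij assms(1) by (metis finite)
  define \<tau> where "\<tau> x = (if x \<in> B then f x else if x \<in> C then h x else x)" for x
  have 1: "bij_betw \<tau> B B'" using f by (subst bij_betw_cong[of _ _ f]) (auto simp: \<tau>_def)
  have 2: "bij_betw \<tau> (C - B) (C - B')" using h by (subst bij_betw_cong[of _ _ h]) (auto simp: \<tau>_def)
  have 3: "bij_betw \<tau> (- C) (- C)" using assms(2) by (subst bij_betw_cong[of _ _ id]) (auto simp: \<tau>_def)
  have 4: "bij_betw \<tau> (B \<union> (C - B)) (B' \<union> (C - B'))" by (intro bij_betw_combine 1 2) auto
  then have 5: "bij_betw \<tau> C C" using assms by (simp add: Un_absorb1)
  have "bij_betw \<tau> (C \<union> - C) (C \<union> - C)" by (intro bij_betw_combine 3 5) auto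
  then have "bij \<tau>" by (simp only: Compl_partition)
  then show ?thesis using 1 5 assms by (intro that[of \<tau>]) (auto simp: bij_betw_def \<tau>_def)
qed

lemma card_Diff_swap: "card V = card W \<Longrightarrow> card (V - W) = card (W - V)"
  for V W :: "'c::finite set"
  by (simp add: card_le_sym_Diff eq_iff)

text \<open>The map follows a bijection from \<open>V - W\<close> to \<open>W - V\<close>, its
  inverse on \<open>W - V\<close>, and the identity elsewhere. Being an involution, it makes the sum
  of a vector and its image invariant.\<close>

lemma swapping_involution:
  fixes V W :: "'c::finite set"
  assumes "card V = card W"
  obtains \<sigma> where "\<And>x. \<sigma> (\<sigma> x) = x" "\<sigma> ` V = W" "\<sigma> ` W = V" "\<And>x. x \<in> V - W \<Longrightarrow> \<sigma> x \<in> W - V"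
proof -
  have "card (V - W) = card (W - V)" using assms by (rule card_Diff_swap)
  then obtain h where h: "bij_betw h (V - W) (W - V)" using finite_same_card_bij by (metis finite)
  let ?i = "inv_into (V - W) h"
  define \<sigma> where "\<sigma> x = (if x \<in> V - W then h x else if x \<in> W - V then ?i x else x)" for x
  have 1: "h x \<in> W - V" "?i (h x) = x" if "x \<in> V - W" for x
    using h that by (auto simp: bij_betw_def)
  have 2: "?i x \<in> V - W" "h (?i x) = x" if "x \<in> W - V" for x
    using h that by (metis bij_betw_def inv_into_into, metis bij_betw_def f_inv_into_f)
  have inv: "\<sigma> (\<sigma> x) = x" for x
    using 1[of x] 2[of x] by (auto simp: \<sigma>_def)
  have VW: "\<sigma> x \<in> W" if "x \<in> V" for x using that 1[of x] by (auto simp: \<sigma>_def)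
  have WV: "\<sigma> x \<in> V" if "x \<in> W" for x using that 2[of x] by (auto simp: \<sigma>_def)
  show thesis
  proof (rule that[of \<sigma>])
    show "\<sigma> ` V = W" using VW WV inv by (metis image_eqI image_subsetI subsetI subset_antisym)
    show "\<sigma> ` W = V" using VW WV inv by (metis image_eqI image_subsetI subsetI subset_antisym)
    show "\<sigma> x \<in> W - V" if "x \<in> V - W" for x using 1[OF that] that by (simp add: \<sigma>_def)
  qed (rule inv)
qed

section \<open>Ballot vectors and scores\<close>

lemma sum_fun_apply: "(\<Sum>i\<in>I. w i) x = (\<Sum>i\<in>I. w i x)"
  by (induction I rule: infinite_finite_induct) auto

lemma of_int_fun_apply: "of_int n x = of_int n"
  by (cases n) (auto simp: of_nat_fun)

definition single :: "'c set \<Rightarrow> 'c set \<Rightarrow> int" where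
  "single A = (\<lambda>B. of_bool (B = A))"

lemma single_apply: "single A B = of_bool (B = A)"
  by (simp add: single_def)

lemma single_comp_image: "bij \<tau> \<Longrightarrow> single (\<tau> ` A) \<circ> image \<tau> = single A"
  by (auto simp: fun_eq_iff single_apply inj_image_eq_iff bij_is_inj)

lemma vec_decomp:
  fixes v :: "'c::finite set \<Rightarrow> int"
  shows "v = (\<Sum>A\<in>UNIV. of_int (v A) * single A)"
  by (simp add: fun_eq_iff sum_fun_apply single_apply of_int_fun_apply sum.delta' of_bool_def if_distrib[of "(*) _"] cong: if_cong)

lemma additive_on_vectors:
  fixes u :: "('b::finite set \<Rightarrow> int) \<Rightarrow> real"
  assumes add: "\<And>x y. u (x + y) = u x + u y"
  shows "u v = (\<Sum>A\<in>UNIV. real_of_int (v A) * u (single A))"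
proof -
  interpret additive u by standard (rule add)
  have nat: "u (of_nat n * x) = real n * u x" for n x
  proof (induction n)
    case 0
    show "u (of_nat 0 * x) = real 0 * u x" using zero by simp
  next
    case (Suc n)
    have "u (of_nat n * x) = real n * u x" by fact
    then have "u (x + of_nat n * x) = real (Suc n) * u x" by (simp add: add algebra_simps)
    then show "u (of_nat (Suc n) * x) = real (Suc n) * u x" by (simp add: algebra_simps)
  qed
  have int: "u (of_int n * x) = real_of_int n * u x" for n x
    by (cases n) (simp_all only: nat minus of_int_of_nat_eq of_int_minus mult_minus_left)
  have "u v = u (\<Sum>A\<in>UNIV. of_int (v A) * single A)" using vec_decomp[of v] by simp
  then show ?thesis by (simp only: sum int)
qed

text \<open>The linear extension of the Thiele score to vectors with negative entries. On the vote
  counts of a profile it agrees with \<open>thiele_score\<close> if \<open>s 0 = 0\<close>, see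
  \<open>thiele_score_votes\<close>.\<close>

definition score :: "(nat \<Rightarrow> real) \<Rightarrow> ('c::finite set \<Rightarrow> int) \<Rightarrow> 'c set \<Rightarrow> real" where
  "score s v W = (\<Sum>A\<in>UNIV. real_of_int (v A) * s (card (A \<inter> W)))"

lemma score_add: "score s (v + w) W = score s v W + score s w W"
  by (simp add: score_def distrib_right sum.distrib)

lemma score_diff: "score s (v - w) W = score s v W - score s w W"
  by (simp add: score_def left_diff_distrib sum_subtractf)

lemma score_uminus: "score s (- v) W = - score s v W"
  by (simp add: score_def sum_negf)

lemma score_of_nat: "score s (of_nat n * v) W = real n * score s v W"
  by (simp add: score_def sum_distrib_left algebra_simps)

lemma score_sum: "score s (\<Sum>i\<in>I. w i) W = (\<Sum>i\<in>I. score s (w i) W)"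
proof -
  interpret additive "\<lambda>v. score s v W" by standard (rule score_add)
  show ?thesis by (rule sum)
qed

lemma score_single: "score s (single A) W = s (card (A \<inter> W))"
proof -
  have "real_of_int (single A B) * s (card (B \<inter> W)) = (if B = A then s (card (A \<inter> W)) else 0)" for B
    by (simp add: single_apply)
  then show ?thesis by (simp add: score_def)
qed

lemma score_comp_image:
  assumes "bij \<tau>"
  shows "score s (v \<circ> image \<tau>) W = score s v (\<tau> ` W)"
proof -
  have inj: "inj \<tau>" using assms by (rule bij_is_inj)
  have "card (\<tau> ` A \<inter> \<tau> ` W) = card (A \<inter> W)" for A
    using inj by (simp add: image_Int[symmetric] card_image inj_on_subset[OF inj])
  then have "score s (v \<circ> image \<tau>) W = (\<Sum>A\<in>UNIV. real_of_int (v (\<tau> ` A)) * s (card (\<tau> ` A \<inter> \<tau> ` W)))"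
    by (simp add: score_def)
  also have "\<dots> = score s v (\<tau> ` W)" unfolding score_def
    by (rule sum.reindex_bij_betw[of "image \<tau>"]) (rule bij_betw_Pow[OF assms, simplified])
  finally show ?thesis .
qed

section \<open>Rules on ballot vectors\<close>

text \<open>The axioms as they look on vectors indexed by all sets of candidates. Since ballots are
  non-empty, \<open>empty_ballot\<close> makes the coordinate at the empty set a dummy. The form of
  \<open>indep\<close> comes from a profile where every committee wins and a single ballot
  \<open>A\<close> is replaced by \<open>A'\<close>.\<close>

locale vector_rule =
  fixes k :: nat and F :: "('c::finite set \<Rightarrow> int) \<Rightarrow> 'c set set"
  assumes k_pos: "1 \<le> k" and k_less: "k < card (UNIV :: 'c set)"
    and nonempty: "F v \<noteq> {}"
    and committee: "W \<in> F v \<Longrightarrow> card W = k"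
    and consist: "F v \<inter> F w \<noteq> {} \<Longrightarrow> F (v + w) = F v \<inter> F w"
    and neut: "bij \<tau> \<Longrightarrow> W \<in> F (v \<circ> image \<tau>) \<longleftrightarrow> \<tau> ` W \<in> F v"
    and empty_ballot: "(\<And>B. B \<noteq> {} \<Longrightarrow> v B = w B) \<Longrightarrow> F v = F w"
    and cont: "\<exists>n\<ge>1. F (of_nat n * v + w) \<subseteq> F v"
    and indep: "A' \<noteq> {} \<Longrightarrow> A' \<subseteq> A \<Longrightarrow> W \<inter> A' = W \<inter> A \<Longrightarrow> card W = k \<Longrightarrow>
      W \<in> F (single A' - single A)"
begin

text \<open>Permutations of the candidates act transitively on committees, so one winner can be
  moved onto any other committee.\<close>

lemma F_symmetric: "F v = committees k" if sym: "\<And>\<tau>. bij \<tau> \<Longrightarrow> v \<circ> image \<tau> = v"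
proof -
  obtain W where W: "W \<in> F v" using nonempty by blast
  have "W' \<in> F v" if "card W' = k" for W'
  proof -
    have "card W = card W'" using committee[OF W] that by simp
    then obtain \<tau> where t: "bij \<tau>" "\<tau> ` W = W'" by (rule bij_image_card)
    then show ?thesis using neut[OF t(1), of W v] W sym[OF t(1)] by simp
  qed
  then show ?thesis using committee by (auto simp: committees_def)
qed

lemma F_zero: "F 0 = committees k"
  by (rule F_symmetric) (auto simp: fun_eq_iff)

lemma add_in: "W \<in> F v \<Longrightarrow> W \<in> F w \<Longrightarrow> W \<in> F (v + w)"
  using consist by blast

lemma add_eq: "W \<in> F v \<Longrightarrow> W \<in> F w \<Longrightarrow> F (v + w) = F v \<inter> F w"
  using consist by blast

lemma F_scale: "n \<ge> 1 \<Longrightarrow> F (of_nat n * v) = F v"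
proof (induction n rule: nat_induct_at_least)
  case base
  show "F (of_nat 1 * v) = F v" by simp
next
  case (Suc n)
  have "F (of_nat n * v) = F v" by fact
  then have "F (v + of_nat n * v) = F v" using consist[of v "of_nat n * v"] nonempty[of v] by simp
  then show "F (of_nat (Suc n) * v) = F v" by (simp add: algebra_simps)
qed

lemma F_sum:
  assumes "finite I" "W \<in> committees k" "\<And>i. i \<in> I \<Longrightarrow> W \<in> F (w i)"
  shows "F (\<Sum>i\<in>I. w i) = {X \<in> committees k. \<forall>i\<in>I. X \<in> F (w i)}"
  using assms(1,3)
proof (induction I rule: finite_induct)
  case empty
  show "F (\<Sum>i\<in>{}. w i) = {X \<in> committees k. \<forall>i\<in>{}. X \<in> F (w i)}" by (simp add: F_zero)
next
  case (insert i I)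
  have IH: "F (\<Sum>i\<in>I. w i) = {X \<in> committees k. \<forall>i\<in>I. X \<in> F (w i)}"
    by (rule insert.IH) (use insert.prems in auto)
  then have "W \<in> F (\<Sum>i\<in>I. w i)" using insert.prems assms(2) by auto
  then have "F (w i + (\<Sum>i\<in>I. w i)) = F (w i) \<inter> F (\<Sum>i\<in>I. w i)"
    using insert.prems by (intro add_eq[of W]) auto
  also have "\<dots> = {X \<in> committees k. \<forall>j\<in>insert i I. X \<in> F (w j)}"
    using IH committee by (auto simp: committees_def)
  finally show "F (\<Sum>j\<in>insert i I. w j) = {X \<in> committees k. \<forall>j\<in>insert i I. X \<in> F (w j)}"
    using insert.hyps by simp
qed

lemma F_all_uminus: "F (- v) = committees k" if "F v = committees k"
proof -
  have "F v \<inter> F (- v) = F (- v)" using that committee by (auto simp: committees_def)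
  then show ?thesis using consist[of v "- v"] nonempty F_zero by simp
qed

lemma F_all_add: "F (v + w) = F w" if "F v = committees k"
proof -
  have "F v \<inter> F w = F w" using that committee by (auto simp: committees_def)
  then show ?thesis using consist[of v w] nonempty by simp
qed

section \<open>Vectors that select the committees with or without a given candidate\<close>

definition nontrivial :: bool where
  "nontrivial \<longleftrightarrow> (\<exists>v. F v \<noteq> committees k)"

text \<open>This is the sum of \<open>single A - single (A - {x})\<close> over all \<open>A\<close> of size \<open>l\<close> containing \<open>x\<close>.
  By independence of losers, every committee avoiding \<open>x\<close> wins at its negative.\<close>

definition incl_vec :: "nat \<Rightarrow> 'c \<Rightarrow> 'c set \<Rightarrow> int" where
  "incl_vec l x B = of_bool (x \<in> B \<and> card B = l) - of_bool (x \<notin> B \<and> card B + 1 = l)"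

lemma incl_vec_comp_image: "bij \<tau> \<Longrightarrow> incl_vec l (\<tau> x) \<circ> image \<tau> = incl_vec l x"
  by (auto simp: fun_eq_iff incl_vec_def card_image inj_image_mem_iff bij_is_inj
      inj_on_subset[OF bij_is_inj subset_UNIV])

text \<open>The full ballot is symmetric, and every other non-empty ballot arises from it by
  removing candidates one at a time. So all committees win at each unit vector, and by consistency
  at all integer combinations of these.\<close>

lemma trivial_if_shrinking_trivial:
  assumes "\<And>A x. x \<in> A \<Longrightarrow> A \<noteq> {x} \<Longrightarrow> F (single (A - {x}) - single A) = committees k"
  shows "F v = committees k"
proof -
  have eU: "F (single UNIV) = committees k"
  proof (rule F_symmetric)
    fix \<tau> :: "'c \<Rightarrow> 'c"
    assume "bij \<tau>"
    then show "single UNIV \<circ> image \<tau> = single UNIV"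
      using single_comp_image[of \<tau> UNIV] by (simp add: bij_is_surj)
  qed
  have e: "F (single A) = committees k" if "A \<noteq> {}" for A
    using that
  proof (induction "card (- A)" arbitrary: A)
    case 0
    then have "A = UNIV" by (simp add: Compl_eq_Diff_UNIV) blast
    then show ?case using eU by simp
  next
    case (Suc n)
    then obtain x where x: "x \<notin> A" by (metis ComplD card.empty ex_in_conv nat.distinct(1))
    have "- A = insert x (- insert x A)" using x by auto
    then have "card (- insert x A) = n" using Suc.hyps(2) by (metis ComplD card_insert_disjoint finite insertI1 nat.inject)
    then have IH: "F (single (insert x A)) = committees k" using Suc by auto
    have "F (single (insert x A - {x}) - single (insert x A)) = committees k"
      using assms[of x "insert x A"] x Suc.prems by auto
    then show ?case using F_all_add[OF IH, of "single A - single (insert x A)"] x by simp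
  qed
  have ne: "F (of_nat n * single A) = committees k" if "A \<noteq> {}" for n A
    by (cases "n \<ge> 1") (use that F_scale e F_zero in \<open>auto simp: not_less_eq_eq\<close>)
  have "F (of_int m * single A) = committees k" if "A \<noteq> {}" for m A
    using ne[OF that] F_all_uminus[OF ne[OF that]] by (cases m) (simp_all only: of_int_of_nat_eq of_int_minus mult_minus_left)
  moreover have "F (of_int m * single {}) = committees k" for m
    unfolding F_zero[symmetric] by (rule empty_ballot) (simp add: single_apply)
  ultimately have "F (of_int m * single A) = committees k" for m A by (cases "A = {}") auto
  moreover obtain W :: "'c set" where "W \<in> committees k" using F_zero nonempty[of 0] by blast
  ultimately have "F (\<Sum>A\<in>UNIV. of_int (v A) * single A) = committees k"
    using F_sum[of UNIV W "\<lambda>A. of_int (v A) * single A"] by simp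
  then show ?thesis using vec_decomp[of v] by simp
qed

text \<open>Nontriviality yields a ballot \<open>A\<close> and a candidate \<open>x\<close> whose
  removal makes some committee lose. Summing the removal of \<open>x\<close> over all ballots of the
  same size makes the vector invariant under permutations fixing \<open>x\<close>. All committees
  avoiding \<open>x\<close> win at every summand. If one containing \<open>x\<close> won at the sum,
  all of them would by symmetry, and then nobody could lose at the summand of
  \<open>A\<close>.\<close>

lemma F_uminus_incl_vec:
  assumes "nontrivial"
  shows "\<exists>l\<ge>2. \<forall>x. F (- incl_vec l x) = {W \<in> committees k. x \<notin> W}"
proof -
  have "\<exists>A x. x \<in> A \<and> A \<noteq> {x} \<and> F (single (A - {x}) - single A) \<noteq> committees k"
  proof (rule ccontr)
    assume "\<not> ?thesis"
    then have no: "\<forall>A x. x \<in> A \<longrightarrow> A \<noteq> {x} \<longrightarrow> F (single (A - {x}) - single A) = committees k"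
      by (simp only: not_ex de_Morgan_conj not_not imp_conv_disj) simp
    have "F v = committees k" for v by (rule trivial_if_shrinking_trivial[OF no[rule_format]])
    then show False using assms by (simp add: nontrivial_def)
  qed
  then obtain A x where Ax: "x \<in> A" "A \<noteq> {x}" "F (single (A - {x}) - single A) \<noteq> committees k" by blast
  define l where "l = card A"
  \<comment> \<open>With at least two candidates in each \<open>B\<close>, the shrunk ballot
    \<open>B - {x}\<close> is non-empty, as \<open>indep\<close> requires.\<close>
  have l2: "l \<ge> 2"
  proof -
    have "A - {x} \<noteq> {}" using Ax(1,2) by blast
    then have "card (A - {x}) \<noteq> 0" by simp
    then show ?thesis using Ax(1) unfolding l_def by (simp add: card_Diff_singleton)
  qed
  define I where "I = {B. x \<in> B \<and> card B = l}"
  have eq: "- incl_vec l x = (\<Sum>B\<in>I. single (B - {x}) - single B)"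
  proof
    fix Y
    have 1: "(\<Sum>B\<in>I. single B Y) = of_bool (x \<in> Y \<and> card Y = l)"
      by (auto simp: single_apply I_def of_bool_def sum.delta)
    have "(\<Sum>B\<in>I. single (B - {x}) Y) = (\<Sum>B\<in>I. of_bool (x \<notin> Y \<and> B = insert x Y))"
      by (intro sum.cong) (auto simp: single_apply I_def)
    also have "\<dots> = of_bool (x \<notin> Y \<and> card Y + 1 = l)"
      by (cases "x \<in> Y") (auto simp: I_def of_bool_def sum.delta)
    finally show "(- incl_vec l x) Y = (\<Sum>B\<in>I. single (B - {x}) - single B) Y"
      using 1 by (simp add: sum_fun_apply incl_vec_def sum_subtractf)
  qed
  have sub: "W \<in> F (single (B - {x}) - single B)" if "x \<notin> W" "card W = k" "B \<in> I" for W B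
    by (rule indep) (use that l2 card_mono[of "{x}" B] in \<open>auto simp: I_def\<close>)
  have "k \<le> card (UNIV - {x})" using k_less by (simp add: card_Diff_singleton)
  then obtain W0 where W0: "W0 \<subseteq> UNIV - {x}" "card W0 = k"
    by (rule obtain_subset_with_card_n) auto
  have Feq: "F (- incl_vec l x) = {X \<in> committees k. \<forall>B\<in>I. X \<in> F (single (B - {x}) - single B)}"
    unfolding eq by (rule F_sum[of _ W0]) (use W0 sub in \<open>auto simp: committees_def\<close>)
  have Fne: "F (- incl_vec l x) \<noteq> committees k"
    using Ax committee unfolding Feq by (auto simp: I_def l_def committees_def)
  have inv: "- incl_vec l (\<tau> y) \<circ> image \<tau> = - incl_vec l y" if "bij \<tau>" for \<tau> y
    using incl_vec_comp_image[OF that, of l y] by (auto simp: fun_eq_iff)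
  have x: "F (- incl_vec l x) = {W \<in> committees k. x \<notin> W}"
  proof (rule ccontr)
    assume "\<not> ?thesis"
    moreover have "{W \<in> committees k. x \<notin> W} \<subseteq> F (- incl_vec l x)"
      unfolding Feq using sub by (auto simp: committees_def)
    ultimately obtain V where V: "V \<in> F (- incl_vec l x)" "x \<in> V"
      using committee by (auto simp: committees_def)
    have "V' \<in> F (- incl_vec l x)" if "card V' = k" for V'
    proof (cases "x \<in> V'")
      case True
      have "card V = card V'" "x \<in> V \<longleftrightarrow> x \<in> V'" using committee[OF V(1)] that True V(2) by auto
      then obtain \<tau> where t: "bij \<tau>" "\<tau> x = x" "\<tau> ` V = V'" by (rule bij_image_card_fixing)
      then show ?thesis using neut[OF t(1), of V "- incl_vec l x"] inv[OF t(1), of x] V by simp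
    next
      case False
      then show ?thesis using \<open>{W \<in> committees k. x \<notin> W} \<subseteq> F (- incl_vec l x)\<close> that
        by (auto simp: committees_def)
    qed
    then show False using Fne committee by (auto simp: committees_def)
  qed
  have "F (- incl_vec l y) = {W \<in> committees k. y \<notin> W}" for y
  proof -
    have "card {x} = card {y}" by simp
    then obtain \<tau> where t: "bij \<tau>" "\<tau> ` {x} = {y}" by (rule bij_image_card)
    then have ty: "\<tau> x = y" by auto
    have "\<tau> ` X \<in> F (- incl_vec l y) \<longleftrightarrow> card (\<tau> ` X) = k \<and> y \<notin> \<tau> ` X" for X
      using neut[OF t(1), of X "- incl_vec l y"] inv[OF t(1), of x] x bij_is_inj[OF t(1)]
      by (simp add: committees_def card_image inj_on_subset inj_image_mem_iff flip: ty)
    then have "W \<in> F (- incl_vec l y) \<longleftrightarrow> card W = k \<and> y \<notin> W" for W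
      using surj_image_vimage_eq[OF bij_is_surj[OF t(1)], of W] by metis
    then show ?thesis by (auto simp: committees_def)
  qed
  then show ?thesis using l2 by blast
qed

text \<open>A committee avoiding \<open>x\<close> wins at the negative vector. If it also won at the
  vector itself, consistency at the sum 0, where everybody wins, would let committees containing
  \<open>x\<close> win at the negative vector too. So all winners contain \<open>x\<close>, and
  symmetry turns one such winner into all.\<close>

lemma F_incl_vec:
  assumes "nontrivial"
  obtains l where "\<And>x. F (- incl_vec l x) = {W \<in> committees k. x \<notin> W}"
    and "\<And>x. F (incl_vec l x) = {W \<in> committees k. x \<in> W}"
proof -
  obtain l where l: "\<And>x. F (- incl_vec l x) = {W \<in> committees k. x \<notin> W}"
    using F_uminus_incl_vec[OF assms] by blast
  have "F (incl_vec l x) = {W \<in> committees k. x \<in> W}" for x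
  proof -
    have no: "x \<in> W" if "W \<in> F (incl_vec l x)" for W
    proof (rule ccontr)
      assume "x \<notin> W"
      then have "W \<in> F (- incl_vec l x)" using that committee l by (auto simp: committees_def)
      then have "F (incl_vec l x + - incl_vec l x) = F (incl_vec l x) \<inter> F (- incl_vec l x)"
        using that by (intro add_eq)
      then have *: "committees k \<subseteq> F (- incl_vec l x)" using F_zero by simp
      obtain V :: "'c set" where "x \<in> V" "card V = k"
      proof -
        obtain V' where "{x} \<subseteq> V'" "card V' = k"
          using exists_subset_between[of "{x}" k UNIV] k_pos k_less by auto
        then show thesis using that by auto
      qed
      then show False using * l by (auto simp: committees_def)
    qed
    obtain V where V: "V \<in> F (incl_vec l x)" using nonempty by blast
    have "V' \<in> F (incl_vec l x)" if "card V' = k" "x \<in> V'" for V'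
    proof -
      have "card V = card V'" "x \<in> V \<longleftrightarrow> x \<in> V'" using committee[OF V] that no[OF V] by auto
      then obtain \<tau> where t: "bij \<tau>" "\<tau> x = x" "\<tau> ` V = V'" by (rule bij_image_card_fixing)
      then show ?thesis using neut[OF t(1), of V "incl_vec l x"] incl_vec_comp_image[OF t(1), of l x] V by simp
    qed
    then show ?thesis using no committee by (auto simp: committees_def)
  qed
  then show thesis using that l by blast
qed

end

locale nontrivial_vector_rule = vector_rule k F
  for k :: nat and F :: "('c::finite set \<Rightarrow> int) \<Rightarrow> 'c set set" +
  fixes l :: nat
  assumes F_incl: "F (incl_vec l x) = {W \<in> committees k. x \<in> W}"
    and F_excl: "F (- incl_vec l x) = {W \<in> committees k. x \<notin> W}"
begin

definition interval_vec :: "'c set \<Rightarrow> 'c set \<Rightarrow> 'c set \<Rightarrow> int" where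
  "interval_vec C U = (\<Sum>x\<in>C. incl_vec l x) + (\<Sum>x\<in>- U. - incl_vec l x)"

lemma F_interval_vec:
  assumes "C \<subseteq> W" "W \<subseteq> U" "card W = k"
  shows "F (interval_vec C U) = {X \<in> committees k. C \<subseteq> X \<and> X \<subseteq> U}"
proof -
  have W: "W \<in> committees k" using assms by (simp add: committees_def)
  have 1: "F (\<Sum>x\<in>C. incl_vec l x) = {X \<in> committees k. \<forall>x\<in>C. X \<in> F (incl_vec l x)}"
    by (rule F_sum[of _ W]) (use W assms in \<open>auto simp: F_incl\<close>)
  have 2: "F (\<Sum>x\<in>- U. - incl_vec l x) = {X \<in> committees k. \<forall>x\<in>- U. X \<in> F (- incl_vec l x)}"
    by (rule F_sum[of _ W]) (use W assms in \<open>auto simp: F_excl\<close>)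
  show ?thesis unfolding interval_vec_def
    by (subst add_eq[of W]) (use W assms in \<open>auto simp: 1 2 F_incl F_excl\<close>)
qed

end

section \<open>Committees differing in one candidate\<close>

context nontrivial_vector_rule
begin

text \<open>The vector \<open>p\<close> has exactly the two winners \<open>V\<close> and
  \<open>V'\<close>, and \<open>P v\<close> says that \<open>V\<close> wins once enough copies of
  \<open>p\<close> are added to \<open>v\<close>. Consistency makes \<open>P\<close> closed under
  addition, and \<open>clash\<close> makes it total, so \<open>archimedean_cone_functional\<close>
  yields a real functional deciding between the two committees.\<close>

lemma adjacent_functional:
  assumes C: "card C = k - 1" "a \<notin> C" "b \<notin> C" "a \<noteq> b"
  obtains u :: "('c set \<Rightarrow> int) \<Rightarrow> real" where "\<And>x y. u (x + y) = u x + u y"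
    and "\<And>v. insert a C \<in> F v \<Longrightarrow> 0 \<le> u v" and "\<And>v. insert b C \<in> F v \<Longrightarrow> u v \<le> 0"
    and "0 < u (incl_vec l a)"
proof -
  define V V' where VV: "V = insert a C" "V' = insert b C"
  define p where "p = interval_vec C (insert a (insert b C))"
  have cV: "card V = k" "card V' = k" using C k_pos by (auto simp: VV)
  have "V \<noteq> V'" using C by (auto simp: VV)
  have Fp: "F p = {V, V'}"
  proof -
    have "X = V \<or> X = V'" if X: "card X = k" "C \<subseteq> X" "X \<subseteq> insert a (insert b C)" for X
    proof -
      have "\<not> X \<subseteq> C" using X C k_pos by (metis card_mono diff_less finite leD less_numeral_extra(1) order_less_le_trans)
      then have "V \<subseteq> X \<or> V' \<subseteq> X" using X by (auto simp: VV)
      then show ?thesis using cV X(1) by (metis card_subset_eq finite)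
    qed
    moreover have "F p = {X \<in> committees k. C \<subseteq> X \<and> X \<subseteq> insert a (insert b C)}"
      unfolding p_def by (rule F_interval_vec[of _ V]) (use cV in \<open>auto simp: VV\<close>)
    ultimately show ?thesis using cV by (auto simp: VV committees_def)
  qed
  have Fnp: "V \<in> F (of_nat n * p)" "V' \<in> F (of_nat n * p)" for n
    using F_scale[of n p] Fp F_zero cV by (cases "n = 0"; auto simp: committees_def)+
  have loc: "\<exists>n\<ge>1. F (of_nat n * p + v) \<subseteq> {V, V'}" for v
    using cont[of p v] Fp by simp
  \<comment> \<open>The two occurrences of \<open>v\<close> cancel. What remains is a positive
    multiple of \<open>p\<close>, at which \<open>V'\<close> cannot be the only winner.\<close>
  have clash: False if "F (of_nat n * p + v) = {V'}" "V' \<in> F (of_nat m * p - v)" "n \<ge> 1" for n m v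
  proof -
    have "F ((of_nat n * p + v) + (of_nat m * p - v)) = {V'}"
      using that add_eq[of V' "of_nat n * p + v" "of_nat m * p - v"] by auto
    moreover have "(of_nat n * p + v) + (of_nat m * p - v) = of_nat (n + m) * p"
      by (simp add: algebra_simps)
    ultimately show False using F_scale[of "n + m" p] that(3) Fp \<open>V \<noteq> V'\<close> by auto
  qed
  define P where "P v \<longleftrightarrow> (\<exists>n. V \<in> F (of_nat n * p + v))" for v
  have notP: "\<exists>n\<ge>1. F (of_nat n * p + v) = {V'}" if "\<not> P v" for v
  proof -
    obtain n where n: "n \<ge> 1" "F (of_nat n * p + v) \<subseteq> {V, V'}" using loc by blast
    moreover have "V \<notin> F (of_nat n * p + v)" using that by (auto simp: P_def)
    ultimately have "F (of_nat n * p + v) = {V'}"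
      using nonempty[of "of_nat n * p + v"] by (metis subset_insert subset_singleton_iff)
    then show ?thesis using n(1) by blast
  qed
  have P_add: "P (v + w)" if h: "P v" "P w" for v w
  proof -
    obtain n m where "V \<in> F (of_nat n * p + v)" "V \<in> F (of_nat m * p + w)"
      using h unfolding P_def by blast
    then have "V \<in> F ((of_nat n * p + v) + (of_nat m * p + w))" by (rule add_in)
    also have "(of_nat n * p + v) + (of_nat m * p + w) = of_nat (n + m) * p + (v + w)"
      by (simp add: algebra_simps)
    finally show ?thesis unfolding P_def by blast
  qed
  have P_total: "P v \<or> P (- v)" for v
  proof (cases "P v")
    case False
    then obtain n where n: "n \<ge> 1" "F (of_nat n * p + v) = {V'}" using notP by blast
    obtain m where "F (of_nat m * p + - v) \<subseteq> {V, V'}" using loc by blast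
    moreover have "V' \<notin> F (of_nat m * p + - v)" using clash[OF n(2) _ n(1), of m] by auto
    ultimately have "V \<in> F (of_nat m * p + - v)"
      using nonempty[of "of_nat m * p + - v"] by (metis subset_insert subset_singleton_iff singletonI insert_commute)
    then show ?thesis unfolding P_def by blast
  qed simp
  \<comment> \<open>Continuity makes the cone Archimedean.\<close>
  have P_arch: "\<exists>n. P (of_nat n * z - x)" if nz: "\<not> P (- z)" for x z
  proof -
    obtain n where n: "n \<ge> 1" "F (of_nat n * p + - z) = {V'}" using notP[OF nz] by blast
    obtain m where "F (of_nat m * p + z) \<subseteq> {V, V'}" using loc by blast
    moreover have "V' \<notin> F (of_nat m * p + z)" using clash[OF n(2) _ n(1), of m] by auto
    ultimately have m: "F (of_nat m * p + z) = {V}"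
      using nonempty[of "of_nat m * p + z"] by (metis subset_insert subset_singleton_iff insert_commute)
    obtain j where "F (of_nat j * (of_nat m * p + z) + - x) \<subseteq> {V}" using cont m by metis
    then have "V \<in> F (of_nat j * (of_nat m * p + z) + - x)"
      using nonempty[of "of_nat j * (of_nat m * p + z) + - x"] by (metis subset_singleton_iff singletonI)
    also have "of_nat j * (of_nat m * p + z) + - x = of_nat (j * m) * p + (of_nat j * z - x)"
      by (simp add: algebra_simps)
    finally show ?thesis unfolding P_def by blast
  qed
  show thesis
  proof (rule archimedean_cone_functional[of P, OF P_add P_total P_arch])
    fix u :: "('c set \<Rightarrow> int) \<Rightarrow> real"
    assume u: "\<And>x y. u (x + y) = u x + u y" "\<And>x. P x \<longleftrightarrow> 0 \<le> u x"
    interpret u: additive u by standard (rule u(1))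
    show thesis
    proof (rule that[of u])
      fix v assume "insert a C \<in> F v"
      then have "V \<in> F (of_nat 0 * p + v)" by (simp add: VV)
      then show "0 \<le> u v" using u(2) unfolding P_def by blast
    next
      fix v assume "insert b C \<in> F v"
      then have V': "V' \<in> F (of_nat 0 * p - (- v))" by (simp add: VV)
      show "u v \<le> 0"
      proof (rule ccontr)
        assume "\<not> u v \<le> 0"
        then have "\<not> P (- v)" using u(2) u.minus by simp
        then show False using notP clash V' by metis
      qed
    next
      \<comment> \<open>\<open>V'\<close> wins both at multiples of \<open>p\<close> and at this
        vector, so consistency gives the exact intersection of the winners. It misses
        \<open>V\<close>, which contains \<open>a\<close>.\<close>
      have "\<not> P (- incl_vec l a)"
      proof
        assume "P (- incl_vec l a)"
        then obtain n where n: "V \<in> F (of_nat n * p + - incl_vec l a)" unfolding P_def by blast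
        have "V' \<in> F (- incl_vec l a)" using cV C by (auto simp: F_excl committees_def VV)
        then have "F (of_nat n * p + - incl_vec l a) = F (of_nat n * p) \<inter> F (- incl_vec l a)"
          using Fnp by (intro add_eq)
        then show False using n by (auto simp: F_excl VV)
      qed
      then show "0 < u (incl_vec l a)" using u(2) u.minus by simp
    qed (rule u(1))
  qed
qed

text \<open>The functional is summed over the group \<open>G\<close> of permutations that fix
  \<open>a\<close>, \<open>b\<close> and the set \<open>C\<close>, and antisymmetrised under the
  swap of \<open>a\<close> and \<open>b\<close>. Elements of \<open>G\<close> preserve both
  committees and the swap exchanges them, so every summand keeps the sign conditions. The identity
  contributes a strictly positive term at \<open>incl_vec l a\<close>.\<close>

lemma adjacent_functional_symmetric:
  assumes C: "card C = k - 1" "a \<notin> C" "b \<notin> C" "a \<noteq> b"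
  obtains u :: "('c set \<Rightarrow> int) \<Rightarrow> real" where "\<And>x y. u (x + y) = u x + u y"
    and "\<And>v. insert a C \<in> F v \<Longrightarrow> 0 \<le> u v" and "\<And>v. insert b C \<in> F v \<Longrightarrow> u v \<le> 0"
    and "0 < u (incl_vec l a)"
    and "\<And>v. u (v \<circ> image (transpose a b)) = - u v"
    and "\<And>v \<rho>. bij \<rho> \<Longrightarrow> \<rho> ` C = C \<Longrightarrow> \<rho> a = a \<Longrightarrow> \<rho> b = b \<Longrightarrow> u (v \<circ> image \<rho>) = u v"
proof (rule adjacent_functional[OF assms])
  fix u :: "('c set \<Rightarrow> int) \<Rightarrow> real"
  assume u: "\<And>x y. u (x + y) = u x + u y"
    "\<And>v. insert a C \<in> F v \<Longrightarrow> 0 \<le> u v" "\<And>v. insert b C \<in> F v \<Longrightarrow> u v \<le> 0"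
    "0 < u (incl_vec l a)"
  let ?s = "transpose a b"
  define G where "G = {\<tau>. bij \<tau> \<and> \<tau> ` C = C \<and> \<tau> a = a \<and> \<tau> b = b}"
  define u' where "u' v = (\<Sum>\<tau>\<in>G. u (v \<circ> image \<tau>) - u (v \<circ> image ?s \<circ> image \<tau>))" for v
  have sC: "?s ` C = C" using C by (auto simp: transpose_image_eq)
  have in_ba: "insert b C \<in> F (v \<circ> image ?s \<circ> image \<tau>)" if "insert a C \<in> F v" "\<tau> \<in> G" for v \<tau>
    using that by (simp add: G_def neut sC bij_imp_bij_inv)
  have in_ab: "insert a C \<in> F (v \<circ> image ?s \<circ> image \<tau>)" if "insert b C \<in> F v" "\<tau> \<in> G" for v \<tau>
    using that by (simp add: G_def neut sC bij_imp_bij_inv)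
  have in_aa: "insert a C \<in> F (v \<circ> image \<tau>)" if "insert a C \<in> F v" "\<tau> \<in> G" for v \<tau>
    using that by (simp add: G_def neut)
  have in_bb: "insert b C \<in> F (v \<circ> image \<tau>)" if "insert b C \<in> F v" "\<tau> \<in> G" for v \<tau>
    using that by (simp add: G_def neut)
  show thesis
  proof (rule that[of u'])
    fix x y :: "'c set \<Rightarrow> int"
    have *: "(x' + y') \<circ> f = (x' \<circ> f) + (y' \<circ> f)" for f :: "'c set \<Rightarrow> 'c set" and x' y' :: "'c set \<Rightarrow> int" by (auto simp: fun_eq_iff)
    show "u' (x + y) = u' x + u' y"
      unfolding u'_def sum.distrib[symmetric] by (intro sum.cong) (simp_all add: * u(1))
  next
    fix v assume v: "insert a C \<in> F v"
    show "0 \<le> u' v" unfolding u'_def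
      using u(2)[OF in_aa[OF v]] u(3)[OF in_ba[OF v]] by (intro sum_nonneg) fastforce
  next
    fix v assume v: "insert b C \<in> F v"
    show "u' v \<le> 0" unfolding u'_def
      using u(3)[OF in_bb[OF v]] u(2)[OF in_ab[OF v]] by (intro sum_nonpos) fastforce
  next
    have v: "insert a C \<in> F (incl_vec l a)" using C k_pos by (auto simp: F_incl committees_def)
    have id: "id \<in> G" by (auto simp: G_def)
    have "0 < u (incl_vec l a \<circ> image id) - u (incl_vec l a \<circ> image ?s \<circ> image id)"
      using u(3)[OF in_ba[OF v id]] u(4) by (simp add: image_id)
    then show "0 < u' (incl_vec l a)" unfolding u'_def
      using u(2)[OF in_aa[OF v]] u(3)[OF in_ba[OF v]] id
      by (intro sum_pos2[of _ id]) (auto, fastforce)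
  next
    fix v :: "'c set \<Rightarrow> int"
    have "v \<circ> image ?s \<circ> image ?s = v" by (simp add: fun_eq_iff image_comp)
    then show "u' (v \<circ> image ?s) = - u' v" unfolding u'_def by (simp flip: sum_negf)
  next
    fix v :: "'c set \<Rightarrow> int" and \<rho> assume r: "bij \<rho>" "\<rho> ` C = C" "\<rho> a = a" "\<rho> b = b"
    \<comment> \<open>Because \<open>\<rho>\<close> commutes with the swap, composing with it merely
      reindexes the sum over \<open>G\<close>.\<close>
    have comm: "\<rho> \<circ> ?s = ?s \<circ> \<rho>"
    proof
      fix x show "(\<rho> \<circ> ?s) x = (?s \<circ> \<rho>) x"
        using r bij_is_inj[OF r(1)] by (auto simp: transpose_def inj_eq)
    qed
    have G: "bij_betw (\<lambda>\<tau>. \<rho> \<circ> \<tau>) G G"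
    proof (rule bij_betw_byWitness[where f' = "\<lambda>\<tau>. inv \<rho> \<circ> \<tau>"])
      have iC: "inv \<rho> ` C = C" by (metis bij_is_inj image_inv_f_f r(1,2))
      have ia: "inv \<rho> a = a" "inv \<rho> b = b" using r by (metis bij_inv_eq_iff)+
      have cC: "(f \<circ> h) ` C = C" if "f ` C = C" "h ` C = C" for f h using that by (metis image_comp)
      show "(\<lambda>\<tau>. \<rho> \<circ> \<tau>) ` G \<subseteq> G"
      proof clarify
        fix \<tau> assume "\<tau> \<in> G"
        then show "\<rho> \<circ> \<tau> \<in> G" using r cC[of \<rho> \<tau>] by (simp add: G_def bij_comp)
      qed
      show "(\<lambda>\<tau>. inv \<rho> \<circ> \<tau>) ` G \<subseteq> G"
      proof clarify
        fix \<tau> assume "\<tau> \<in> G"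
        then show "inv \<rho> \<circ> \<tau> \<in> G"
          using bij_imp_bij_inv[OF r(1)] iC ia cC[of "inv \<rho>" \<tau>] by (simp add: G_def bij_comp)
      qed
      show "\<forall>\<tau>\<in>G. inv \<rho> \<circ> (\<rho> \<circ> \<tau>) = \<tau>" using r(1) by (auto simp: fun_eq_iff bij_is_inj)
      show "\<forall>\<tau>\<in>G. \<rho> \<circ> (inv \<rho> \<circ> \<tau>) = \<tau>" using r(1) by (auto simp: fun_eq_iff bij_is_surj surj_f_inv_f)
    qed
    have 1: "v \<circ> image \<rho> \<circ> image \<tau> = v \<circ> image (\<rho> \<circ> \<tau>)" for \<tau>
      by (auto simp: fun_eq_iff image_comp)
    have 2: "v \<circ> image \<rho> \<circ> image ?s \<circ> image \<tau> = v \<circ> image ?s \<circ> image (\<rho> \<circ> \<tau>)" for \<tau>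
    proof -
      have "\<rho> ` ?s ` A = ?s ` \<rho> ` A" for A using comm by (metis image_comp)
      then have "\<rho> ` ?s ` \<tau> ` A = ?s ` (\<rho> \<circ> \<tau>) ` A" for A by (metis image_comp)
      then show ?thesis by (simp only: fun_eq_iff o_apply) simp
    qed
    show "u' (v \<circ> image \<rho>) = u' v" unfolding u'_def 2 unfolding 1
      by (rule sum.reindex_bij_betw[OF G, of "\<lambda>\<tau>. u (v \<circ> image \<tau>) - u (v \<circ> image ?s \<circ> image \<tau>)"])
  qed
qed

text \<open>Antisymmetry makes \<open>u\<close> vanish on ballots with both or neither of
  \<open>a\<close> and \<open>b\<close>. On a ballot with \<open>a\<close> alone, independence of
  losers for the two committees gives opposite inequalities for the removal of candidates outside
  both, so only the part in \<open>C\<close> matters, and by symmetry only its size. This value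
  \<open>g\<close> is the increment of the sought scoring function.\<close>

lemma adjacent_scoring:
  assumes C: "card C = k - 1" "a \<notin> C" "b \<notin> C" "a \<noteq> b"
  obtains g :: "nat \<Rightarrow> real" where "\<And>j. 0 \<le> g j"
    and "\<And>v. insert a C \<in> F v \<Longrightarrow>
      score (\<lambda>n. \<Sum>j<n. g j) v (insert b C) \<le> score (\<lambda>n. \<Sum>j<n. g j) v (insert a C)"
    and "score (\<lambda>n. \<Sum>j<n. g j) (incl_vec l a) (insert b C) < score (\<lambda>n. \<Sum>j<n. g j) (incl_vec l a) (insert a C)"
proof (rule adjacent_functional_symmetric[OF assms])
  fix u :: "('c set \<Rightarrow> int) \<Rightarrow> real"
  assume u: "\<And>x y. u (x + y) = u x + u y"
    "\<And>v. insert a C \<in> F v \<Longrightarrow> 0 \<le> u v" "\<And>v. insert b C \<in> F v \<Longrightarrow> u v \<le> 0"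
    "0 < u (incl_vec l a)" "\<And>v. u (v \<circ> image (transpose a b)) = - u v"
    "\<And>v \<rho>. bij \<rho> \<Longrightarrow> \<rho> ` C = C \<Longrightarrow> \<rho> a = a \<Longrightarrow> \<rho> b = b \<Longrightarrow> u (v \<circ> image \<rho>) = u v"
  interpret u: additive u by standard (rule u(1))
  have cV: "card (insert a C) = k" "card (insert b C) = k" using C k_pos by auto
  have mono: "u (single A) \<le> u (single A')"
    if "A' \<noteq> {}" "A' \<subseteq> A" "insert a C \<inter> A' = insert a C \<inter> A" for A A'
    using u(2)[OF indep[OF that cV(1)]] by (simp add: u.diff)
  have mono': "u (single A') \<le> u (single A)"
    if "A' \<noteq> {}" "A' \<subseteq> A" "insert b C \<inter> A' = insert b C \<inter> A" for A A'
    using u(3)[OF indep[OF that cV(2)]] by (simp add: u.diff)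
  have swap: "u (single (transpose a b ` A)) = - u (single A)" for A
    using u(5)[of "single (transpose a b ` A)"] single_comp_image[of "transpose a b" A] by simp
  have swap0: "u (single A) = 0" if "a \<in> A \<longleftrightarrow> b \<in> A" for A
    using swap[of A] that by (simp add: transpose_image_eq)
  \<comment> \<open>By \<open>g_eq\<close> the choice of \<open>B\<close> is immaterial. Subsets of
    \<open>C\<close> have fewer than \<open>k\<close> elements; the default 0 beyond that keeps
    \<open>g\<close> non-negative everywhere.\<close>
  define g where "g j = (if j < k then u (single (insert a (SOME B. B \<subseteq> C \<and> card B = j))) else 0)" for j
  have g_eq: "u (single (insert a B)) = g (card B)" if B: "B \<subseteq> C" for B
  proof -
    have lt: "card B < k" using card_mono[OF _ B] C(1) k_pos by simp
    let ?B = "SOME B'. B' \<subseteq> C \<and> card B' = card B"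
    have B': "?B \<subseteq> C \<and> card ?B = card B" by (rule someI[of _ B]) (simp add: B)
    then obtain \<tau> where t: "bij \<tau>" "\<tau> ` B = ?B" "\<tau> ` C = C" "\<And>x. x \<notin> C \<Longrightarrow> \<tau> x = x"
      using bij_image_subset_fixing_outside[of B ?B C] B by metis
    have "u (single (insert a ?B) \<circ> image \<tau>) = u (single (insert a ?B))"
      by (rule u(6)) (use t C in auto)
    moreover have "\<tau> ` insert a B = insert a ?B" using t C by simp
    ultimately show ?thesis using single_comp_image[OF t(1), of "insert a B"] lt by (simp add: g_def)
  qed
  have ua: "u (single A) = g (card (A \<inter> C))" if "a \<in> A" "b \<notin> A" for A
  proof -
    have "u (single A) = u (single (insert a (A \<inter> C)))"
      by (rule antisym[OF mono mono']) (use that in auto)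
    then show ?thesis using g_eq by simp
  qed
  have u_single: "u (single A) = g (card (A \<inter> C)) * (of_bool (a \<in> A) - of_bool (b \<in> A))" for A
  proof -
    consider "a \<in> A \<longleftrightarrow> b \<in> A" | "a \<in> A" "b \<notin> A" | "a \<notin> A" "b \<in> A" by blast
    then show ?thesis
    proof cases
      case 3
      let ?A = "transpose a b ` A"
      have "?A = insert a (A - {b})" using 3 by (auto simp: transpose_def image_iff split: if_splits)
      then have "a \<in> ?A" "b \<notin> ?A" "?A \<inter> C = A \<inter> C" using 3 C by auto
      then have "u (single ?A) = g (card (A \<inter> C))" using ua by metis
      then show ?thesis using swap[of A] 3 by simp
    qed (use ua swap0 in auto)
  qed
  have g0: "0 \<le> g j" for j
  proof (cases "j < k")
    case True
    then obtain B where B: "B \<subseteq> C" "card B = j"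
      using obtain_subset_with_card_n[of j C] C(1) by (metis Suc_diff_1 k_pos less_Suc_eq_le One_nat_def less_eq_Suc_le)
    \<comment> \<open>Non-negativity: dropping the loser \<open>b\<close> from a ballot with both
      \<open>a\<close> and \<open>b\<close>, whose value is 0, cannot hurt the committee with
      \<open>a\<close>.\<close>
    have "u (single (insert a (insert b B))) \<le> u (single (insert a B))"
      by (rule mono) (use B C in auto)
    then show ?thesis using g_eq[OF B(1)] swap0[of "insert a (insert b B)"] B by simp
  qed (simp add: g_def)
  let ?S = "\<lambda>n. \<Sum>j<n. g j"
  have diff: "score ?S v (insert a C) - score ?S v (insert b C) = u v" for v
  proof -
    have c: "card (A \<inter> insert x C) = card (A \<inter> C) + of_bool (x \<in> A)" if "x \<notin> C" for x A
      using that by (cases "x \<in> A") auto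
    have "?S (card (A \<inter> insert a C)) - ?S (card (A \<inter> insert b C)) = u (single A)" for A
      using C by (simp add: c u_single)
    then show ?thesis unfolding additive_on_vectors[OF u(1), of v] score_def
      by (simp add: sum_subtractf[symmetric] right_diff_distrib[symmetric])
  qed
  show thesis
  proof (rule that[of g])
    show "score ?S v (insert b C) \<le> score ?S v (insert a C)" if "insert a C \<in> F v" for v
      using diff[of v] u(2)[OF that] by linarith
    show "score ?S (incl_vec l a) (insert b C) < score ?S (incl_vec l a) (insert a C)"
      using diff[of "incl_vec l a"] u(4) by linarith
  qed (rule g0)
qed

end

section \<open>One scoring function for all pairs of neighbouring committees\<close>

context nontrivial_vector_rule
begin

text \<open>A single triple \<open>C\<close>, \<open>a\<close>, \<open>b\<close> determines
  \<open>g\<close>; it exists because \<open>k\<close> is less than the number of candidates.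
  Permutations map this triple to any other, so neutrality transfers the inequalities with the same
  \<open>g\<close>.\<close>

lemma local_scoring:
  obtains g :: "nat \<Rightarrow> real" where "\<And>j. 0 \<le> g j"
    and "\<And>C a b v. card C = k - 1 \<Longrightarrow> a \<notin> C \<Longrightarrow> b \<notin> C \<Longrightarrow> a \<noteq> b \<Longrightarrow> insert a C \<in> F v \<Longrightarrow>
      score (\<lambda>n. \<Sum>j<n. g j) v (insert b C) \<le> score (\<lambda>n. \<Sum>j<n. g j) v (insert a C)"
    and "\<And>C a b. card C = k - 1 \<Longrightarrow> a \<notin> C \<Longrightarrow> b \<notin> C \<Longrightarrow> a \<noteq> b \<Longrightarrow>
      score (\<lambda>n. \<Sum>j<n. g j) (incl_vec l a) (insert b C) < score (\<lambda>n. \<Sum>j<n. g j) (incl_vec l a) (insert a C)"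
proof -
  have "k - 1 \<le> card (UNIV :: 'c set)" using k_less by simp
  then obtain C :: "'c set" where C: "card C = k - 1" by (rule obtain_subset_with_card_n)
  have "C \<noteq> UNIV" using C k_less by auto
  then obtain a where a: "a \<notin> C" by blast
  have "insert a C \<noteq> UNIV" using C k_less k_pos a by (metis Suc_diff_le card_insert_disjoint diff_Suc_1 finite less_irrefl_nat One_nat_def)
  then obtain b where b: "b \<notin> insert a C" by blast
  have "a \<noteq> b" "b \<notin> C" using b by auto
  show thesis
  proof (rule adjacent_scoring[OF C a \<open>b \<notin> C\<close> \<open>a \<noteq> b\<close>])
    fix g :: "nat \<Rightarrow> real"
    assume g: "\<And>j. 0 \<le> g j"
      "\<And>v. insert a C \<in> F v \<Longrightarrow>
        score (\<lambda>n. \<Sum>j<n. g j) v (insert b C) \<le> score (\<lambda>n. \<Sum>j<n. g j) v (insert a C)"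
      "score (\<lambda>n. \<Sum>j<n. g j) (incl_vec l a) (insert b C) < score (\<lambda>n. \<Sum>j<n. g j) (incl_vec l a) (insert a C)"
    have perm: "\<exists>\<tau>. bij \<tau> \<and> \<tau> ` C = C' \<and> \<tau> a = a' \<and> \<tau> b = b'"
      if C': "card C' = k - 1" "a' \<notin> C'" "b' \<notin> C'" "a' \<noteq> b'" for C' :: "'c set" and a' b'
    proof -
      have "card C = card C'" "card {a} = card {a'}" "card {b} = card {b'}" using C C' by auto
      then obtain \<tau> where "bij \<tau>" "\<tau> ` C = C'" "\<tau> ` {a} = {a'}" "\<tau> ` {b} = {b'}"
        by (rule bij_image_three_blocks) (use a b C' in auto)
      then show ?thesis by (intro exI[of _ \<tau>]) auto
    qed
    show thesis
    proof (rule that[of g])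
      fix C' :: "'c set" and a' b' v
      assume *: "card C' = k - 1" "a' \<notin> C'" "b' \<notin> C'" "a' \<noteq> b'" and v: "insert a' C' \<in> F v"
      obtain \<tau> where t: "bij \<tau>" "\<tau> ` C = C'" "\<tau> a = a'" "\<tau> b = b'" using perm[OF *] by blast
      have "insert a C \<in> F (v \<circ> image \<tau>)" using t v by (simp add: neut)
      from g(2)[OF this] t
      show "score (\<lambda>n. \<Sum>j<n. g j) v (insert b' C') \<le> score (\<lambda>n. \<Sum>j<n. g j) v (insert a' C')"
        by (simp add: score_comp_image)
    next
      fix C' :: "'c set" and a' b'
      assume *: "card C' = k - 1" "a' \<notin> C'" "b' \<notin> C'" "a' \<noteq> b'"
      obtain \<tau> where t: "bij \<tau>" "\<tau> ` C = C'" "\<tau> a = a'" "\<tau> b = b'" using perm[OF *] by blast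
      have "incl_vec l a = incl_vec l a' \<circ> image \<tau>" using incl_vec_comp_image[OF t(1), of l a] t(3) by simp
      then show "score (\<lambda>n. \<Sum>j<n. g j) (incl_vec l a') (insert b' C') < score (\<lambda>n. \<Sum>j<n. g j) (incl_vec l a') (insert a' C')"
        using g(3) t by (simp add: score_comp_image)
    qed (rule g(1))
  qed
qed

end

section \<open>From neighbours to all committees\<close>

locale locally_scored_rule = nontrivial_vector_rule k F l
  for k :: nat and F :: "('c::finite set \<Rightarrow> int) \<Rightarrow> 'c set set" and l :: nat +
  fixes g :: "nat \<Rightarrow> real"
  assumes local_le: "card C = k - 1 \<Longrightarrow> a \<notin> C \<Longrightarrow> b \<notin> C \<Longrightarrow> a \<noteq> b \<Longrightarrow> insert a C \<in> F v \<Longrightarrow>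
      score (\<lambda>n. \<Sum>j<n. g j) v (insert b C) \<le> score (\<lambda>n. \<Sum>j<n. g j) v (insert a C)"
    and incl_less: "card C = k - 1 \<Longrightarrow> a \<notin> C \<Longrightarrow> b \<notin> C \<Longrightarrow> a \<noteq> b \<Longrightarrow>
      score (\<lambda>n. \<Sum>j<n. g j) (incl_vec l a) (insert b C) < score (\<lambda>n. \<Sum>j<n. g j) (incl_vec l a) (insert a C)"
begin

section \<open>Vectors whose score is a product of two exchange signs\<close>

abbreviation S :: "('c set \<Rightarrow> int) \<Rightarrow> 'c set \<Rightarrow> real" where
  "S \<equiv> score (\<lambda>n. \<Sum>j<n. g j)"

definition sgn_pair :: "'c \<Rightarrow> 'c \<Rightarrow> 'c set \<Rightarrow> real" where
  "sgn_pair a b X = of_bool (a \<in> X) - of_bool (b \<in> X)"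

text \<open>A mixed second difference of ballots over a common part \<open>B\<close>:
  \<open>a\<close> against \<open>b\<close> in one direction, \<open>a'\<close> against
  \<open>b'\<close> in the other. In its score the first-order effects cancel, leaving a second
  difference of the scoring function times two signs.\<close>

definition square_vec :: "'c \<Rightarrow> 'c \<Rightarrow> 'c \<Rightarrow> 'c \<Rightarrow> 'c set \<Rightarrow> 'c set \<Rightarrow> int" where
  "square_vec a b a' b' B = single (insert a (insert a' B)) + single (insert b (insert b' B))
     - single (insert a (insert b' B)) - single (insert b (insert a' B))"

lemma S_square_vec:
  assumes "distinct [a, b, a', b']" "B \<inter> {a, b, a', b'} = {}"
  shows "S (square_vec a b a' b' B) X =
    (g (Suc (card (B \<inter> X))) - g (card (B \<inter> X))) * sgn_pair a b X * sgn_pair a' b' X"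
proof -
  have c: "card (insert x (insert y B) \<inter> X) = card (B \<inter> X) + of_bool (x \<in> X) + of_bool (y \<in> X)"
    if "x \<noteq> y" "x \<notin> B" "y \<notin> B" for x y
    using that by (cases "x \<in> X"; cases "y \<in> X") auto
  have "S (square_vec a b a' b' B) X = (\<Sum>j<card (insert a (insert a' B) \<inter> X). g j)
      + (\<Sum>j<card (insert b (insert b' B) \<inter> X). g j)
      - (\<Sum>j<card (insert a (insert b' B) \<inter> X). g j) - (\<Sum>j<card (insert b (insert a' B) \<inter> X). g j)"
    unfolding square_vec_def by (simp only: score_add score_diff score_single)
  also have "\<dots> = (g (Suc (card (B \<inter> X))) - g (card (B \<inter> X))) * sgn_pair a b X * sgn_pair a' b' X"
    using assms by (simp add: c sgn_pair_def of_bool_def)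
  finally show ?thesis .
qed

text \<open>Summing over all \<open>B\<close> of the size \<open>c\<close> of the first nonzero second difference
  makes the dependence on \<open>B \<inter> X\<close> collapse to a constant.\<close>

lemma quadratic_vec_exists:
  assumes dist: "distinct [a, b, a', b']" and nonlin: "Suc c0 < k" "g (Suc c0) \<noteq> g c0"
  obtains R \<gamma> where "\<gamma> \<noteq> 0"
    "\<And>X. card X = k \<Longrightarrow> S R X = \<gamma> * sgn_pair a b X * sgn_pair a' b' X"
proof -
  define c where "c = (LEAST c. g (Suc c) \<noteq> g c)"
  have c: "g (Suc c) \<noteq> g c" unfolding c_def using nonlin(2) by (rule LeastI)
  have cmin: "g (Suc n) = g n" if "n < c" for n using not_less_Least that unfolding c_def by blast
  have "c \<le> c0" unfolding c_def using nonlin(2) by (rule Least_le)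
  then have ck: "c \<le> k - 2" using nonlin(1) by linarith
  let ?Q = "{a, b, a', b'}"
  define I where "I = {B. B \<inter> ?Q = {} \<and> card B = c}"
  define R where "R = (\<Sum>B\<in>I. square_vec a b a' b' B)"
  \<comment> \<open>The binomial coefficient counts the sets \<open>B\<close> of size
    \<open>c\<close> among the \<open>k - 2\<close> members of \<open>X\<close> outside the four
    candidates. It is non-zero since \<open>c \<le> k - 2\<close>.\<close>
  define \<gamma> where "\<gamma> = real ((k - 2) choose c) * (g (Suc c) - g c)"
  have "\<gamma> \<noteq> 0" using c ck by (simp add: \<gamma>_def)
  moreover have "S R X = \<gamma> * sgn_pair a b X * sgn_pair a' b' X" if X: "card X = k" for X
  proof -
    have SR: "S R X = (\<Sum>B\<in>I. g (Suc (card (B \<inter> X))) - g (card (B \<inter> X))) * sgn_pair a b X * sgn_pair a' b' X"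
      unfolding R_def score_sum sum_distrib_right
      by (intro sum.cong) (use dist in \<open>auto simp: I_def intro!: S_square_vec\<close>)
    show ?thesis
    proof (cases "sgn_pair a b X * sgn_pair a' b' X = 0")
      case True
      then show ?thesis using SR by (metis mult.assoc mult_zero_right)
    next
      case False
      \<comment> \<open>A non-zero product of signs means that \<open>X\<close> contains exactly one
        candidate of each pair.\<close>
      then have "(a \<in> X \<longleftrightarrow> b \<notin> X) \<and> (a' \<in> X \<longleftrightarrow> b' \<notin> X)"
        by (simp add: sgn_pair_def of_bool_def split: if_splits)
      then have "card (X \<inter> ?Q) = 2"
        using dist by (cases "a \<in> X"; cases "a' \<in> X") (simp_all add: Int_insert_right)
      then have cX: "card (X - ?Q) = k - 2" using X by (metis card_Diff_subset_Int finite)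
      have "(\<Sum>B\<in>I. g (Suc (card (B \<inter> X))) - g (card (B \<inter> X))) = (\<Sum>B\<in>I. if B \<subseteq> X then g (Suc c) - g c else 0)"
      proof (intro sum.cong refl)
        fix B assume B: "B \<in> I"
        show "g (Suc (card (B \<inter> X))) - g (card (B \<inter> X)) = (if B \<subseteq> X then g (Suc c) - g c else 0)"
        proof (cases "B \<subseteq> X")
          case True
          then show ?thesis using B by (simp add: I_def Int_absorb2)
        next
          case False
          then have "B \<inter> X \<subset> B" by auto
          then have "card (B \<inter> X) < c" using B psubset_card_mono[of B "B \<inter> X"] by (simp add: I_def)
          then show ?thesis using False cmin by simp
        qed
      qed
      also have "\<dots> = (\<Sum>B\<in>{B \<in> I. B \<subseteq> X}. g (Suc c) - g c)" by (simp only: sum.inter_filter[OF finite])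
      also have "{B \<in> I. B \<subseteq> X} = {B. B \<subseteq> X - ?Q \<and> card B = c}" by (auto simp: I_def)
      also have "(\<Sum>B\<in>\<dots>. g (Suc c) - g c) = \<gamma>"
        using n_subsets[of "X - ?Q" c] cX by (simp add: \<gamma>_def)
      finally show ?thesis using SR by simp
    qed
  qed
  ultimately show thesis using that by blast
qed

text \<open>The product of the two signs never exceeds 1. It is 1 at \<open>V\<close>, where both
  signs are 1, and at \<open>W\<close>, where both are -1; exchanging only \<open>a\<close> flips
  one sign and gives -1. A negative factor is repaired by negating the vector. Adding the
  \<open>\<sigma>\<close>-image gives invariance and doubles the score, since
  \<open>\<sigma>\<close> flips both signs.\<close>

lemma tilting_vec_exists:
  assumes \<sigma>: "\<And>x. \<sigma> (\<sigma> x) = x" "\<And>x. x \<in> V - W \<Longrightarrow> \<sigma> x \<in> W - V"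
    and V: "card V = k" "a \<in> V - W" "a' \<in> V - W" "a \<noteq> a'"
    and W: "card W = k"
    and nonlin: "Suc c0 < k" "g (Suc c0) \<noteq> g c0"
  obtains r where "r \<circ> image \<sigma> = r" "S r W = S r V" "\<And>X. card X = k \<Longrightarrow> S r X \<le> S r V"
    "S r (insert (\<sigma> a) (V - {a})) < S r V"
proof -
  let ?b = "\<sigma> a" and ?b' = "\<sigma> a'"
  have bij: "bij \<sigma>" using \<sigma>(1) by (rule involuntory_imp_bij)
  have inj: "\<sigma> x = \<sigma> y \<longleftrightarrow> x = y" for x y using \<sigma>(1) by metis
  have mem: "x \<in> \<sigma> ` X \<longleftrightarrow> \<sigma> x \<in> X" for x X using \<sigma>(1) by (metis image_iff)
  have dist: "distinct [a, ?b, a', ?b']" using V \<sigma>(2)[OF V(2)] \<sigma>(2)[OF V(3)] by (auto simp: inj)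
  obtain R \<gamma> where R: "\<gamma> \<noteq> 0"
    "\<And>X. card X = k \<Longrightarrow> S R X = \<gamma> * sgn_pair a ?b X * sgn_pair a' ?b' X"
    using quadratic_vec_exists[OF dist nonlin] by blast
  obtain R' \<gamma>' where R': "\<gamma>' > 0"
    "\<And>X. card X = k \<Longrightarrow> S R' X = \<gamma>' * sgn_pair a ?b X * sgn_pair a' ?b' X"
  proof (cases "\<gamma> > 0")
    case True
    then show thesis using that R by blast
  next
    case False
    then show thesis using that[of "- \<gamma>" "- R"] R by (simp add: score_uminus)
  qed
  define r where "r = R' + (R' \<circ> image \<sigma>)"
  have Sr: "S r X = 2 * \<gamma>' * (sgn_pair a ?b X * sgn_pair a' ?b' X)" if "card X = k" for X
  proof -
    have "card (\<sigma> ` X) = k" using that bij by (metis bij_is_inj card_image inj_on_subset subset_UNIV)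
    moreover have "sgn_pair x (\<sigma> x) (\<sigma> ` X) = - sgn_pair x (\<sigma> x) X" for x
      by (simp add: sgn_pair_def mem \<sigma>(1))
    ultimately show ?thesis using that by (simp add: r_def score_add score_comp_image[OF bij] R'(2))
  qed
  have one: "sgn_pair a ?b V = 1" "sgn_pair a' ?b' V = 1" "sgn_pair a ?b W = -1" "sgn_pair a' ?b' W = -1"
    using V \<sigma>(2)[OF V(2)] \<sigma>(2)[OF V(3)] by (auto simp: sgn_pair_def)
  have SrV: "S r V = 2 * \<gamma>'" "S r W = 2 * \<gamma>'" using Sr one V W by auto
  show thesis
  proof (rule that[of r])
    show "r \<circ> image \<sigma> = r" by (auto simp: r_def fun_eq_iff image_image \<sigma>(1))
    show "S r W = S r V" using SrV by simp
    show "S r X \<le> S r V" if "card X = k" for X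
    proof -
      have "sgn_pair a ?b X * sgn_pair a' ?b' X \<le> 1" by (auto simp: sgn_pair_def of_bool_def)
      then show ?thesis using Sr[OF that] SrV R'(1) by simp
    qed
    let ?X = "insert ?b (V - {a})"
    have "card ?X = k" using V \<sigma>(2)[OF V(2)] k_pos by (simp add: card_Diff_singleton)
    moreover have "sgn_pair a ?b ?X = -1" "sgn_pair a' ?b' ?X = 1"
      using V \<sigma>(2)[OF V(2)] \<sigma>(2)[OF V(3)] dist by (auto simp: sgn_pair_def)
    ultimately show "S r ?X < S r V" using Sr SrV R'(1) by simp
  qed
qed

end

section \<open>Comparison of distant committees by induction\<close>

context locally_scored_rule
begin

text \<open>With constant increments, a ballot's score is proportional to the number of approved
  members. The total over \<open>V\<close> and \<open>W\<close> therefore does not change when they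
  trade \<open>a\<close> for \<open>b\<close>. Constancy below \<open>k\<close> suffices because no
  ballot approves more than \<open>k\<close> members of a committee.\<close>

lemma exchange_identity_linear:
  assumes lin: "\<And>j. j < k \<Longrightarrow> g j = g 0"
    and V: "card V = k" "a \<in> V" "b \<notin> V" and W: "card W = k" "b \<in> W" "a \<notin> W"
  shows "S v (insert b (V - {a})) + S v (insert a (W - {b})) = S v V + S v W"
proof -
  have s: "(\<Sum>j<n. g j) = real n * g 0" if "n \<le> k" for n
  proof -
    have "(\<Sum>j<n. g j) = (\<Sum>j<n. g 0)" by (intro sum.cong refl lin) (use that in auto)
    then show ?thesis by simp
  qed
  have cV: "card (A \<inter> insert x X) = card (A \<inter> X) + of_bool (x \<in> A)" if "x \<notin> X" for x X and A :: "'c set"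
    using that by (cases "x \<in> A") auto
  have le: "card (A \<inter> X) + of_bool (x \<in> A) \<le> k" if "x \<notin> X" "card X = k - 1" for x X and A :: "'c set"
    using that card_mono[of "insert x X" "A \<inter> insert x X"] k_pos cV[of x X A] by simp
  have cc: "card (V - {a}) = k - 1" "card (W - {b}) = k - 1" using V W by (auto simp: card_Diff_singleton)
  have VW: "V = insert a (V - {a})" "W = insert b (W - {b})" using V W by auto
  let ?s = "\<lambda>n. \<Sum>j<n. g j"
  have "?s (card (A \<inter> insert b (V - {a}))) + ?s (card (A \<inter> insert a (W - {b})))
      = ?s (card (A \<inter> V)) + ?s (card (A \<inter> W))" for A
  proof -
    have "?s (card (A \<inter> V)) = real (card (A \<inter> (V - {a})) + of_bool (a \<in> A)) * g 0"
      using cV[of a "V - {a}" A] le[of a "V - {a}" A] cc VW(1) by (metis Diff_iff insertCI s)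
    moreover have "?s (card (A \<inter> W)) = real (card (A \<inter> (W - {b})) + of_bool (b \<in> A)) * g 0"
      using cV[of b "W - {b}" A] le[of b "W - {b}" A] cc VW(2) by (metis Diff_iff insertCI s)
    moreover have "?s (card (A \<inter> insert b (V - {a}))) = real (card (A \<inter> (V - {a})) + of_bool (b \<in> A)) * g 0"
      using cV[of b "V - {a}" A] le[of b "V - {a}" A] cc V by (metis Diff_iff s)
    moreover have "?s (card (A \<inter> insert a (W - {b}))) = real (card (A \<inter> (W - {b})) + of_bool (a \<in> A)) * g 0"
      using cV[of a "W - {b}" A] le[of a "W - {b}" A] cc W by (metis Diff_iff s)
    ultimately show ?thesis by (simp add: algebra_simps)
  qed
  then show ?thesis unfolding score_def by (simp add: sum.distrib[symmetric] distrib_left[symmetric])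
qed

text \<open>The induction on \<open>k - card (V \<inter> W)\<close> leaves the vector arbitrary,
  because the hypothesis is used at the auxiliary vectors \<open>p\<close> and \<open>z\<close> as
  well as at \<open>v\<close>.\<close>

lemma F_maximises:
  "V \<in> F v \<Longrightarrow> card W = k \<Longrightarrow> S v W \<le> S v V"
proof (induction "k - card (V \<inter> W)" arbitrary: V W v rule: less_induct)
  case less
  have Vv: "V \<in> F v" and cW: "card W = k" by fact+
  have cV: "card V = k" using committee[OF Vv] .
  have IH: "S x Y \<le> S x X" if "card (V \<inter> W) < card (X \<inter> Y)" "X \<in> F x" "card Y = k" for X Y x
  proof (rule less.hyps[OF _ that(2,3)])
    have "card (X \<inter> Y) \<le> k" using card_mono[of Y "X \<inter> Y"] that(3) by simp
    then show "k - card (X \<inter> Y) < k - card (V \<inter> W)" using that(1) by linarith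
  qed
  have VI: "V = (V \<inter> W) \<union> (V - W)" "W = (V \<inter> W) \<union> (W - V)" by auto
  have card_eq: "card (V - W) = card (W - V)" by (rule card_Diff_swap) (simp add: cV cW)
  consider "card (V - W) = 0" | "card (V - W) = 1" | "card (V - W) \<ge> 2" by linarith
  then show "S v W \<le> S v V"
  proof cases
    case 1
    then have "V \<subseteq> W" by simp
    then have "V = W" using cV cW by (intro card_subset_eq) auto
    then show ?thesis by simp
  next
    case 2
    then obtain a b where ab: "V - W = {a}" "W - V = {b}" using card_eq by (metis card_1_singletonE)
    let ?C = "V \<inter> W"
    have V: "V = insert a ?C" "W = insert b ?C" using ab by auto
    have mem: "a \<notin> ?C" "b \<notin> ?C" "a \<noteq> b" using ab by auto
    have "Suc (card ?C) = k" using cV V(1) mem(1) by (metis card_insert_disjoint finite)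
    then have "card ?C = k - 1" by simp
    from local_le[OF this mem, of v] Vv V show ?thesis by simp
  next
    case 3
    have int_lt: "card (V \<inter> W) + 2 \<le> k"
      using 3 cV card_Diff_subset_Int[of V W] card_mono[of V "V \<inter> W"] by simp
    obtain \<sigma> where \<sigma>: "\<And>x. \<sigma> (\<sigma> x) = x" "\<sigma> ` V = W" "\<sigma> ` W = V" "\<And>x. x \<in> V - W \<Longrightarrow> \<sigma> x \<in> W - V"
      using swapping_involution[of V W] cV cW by metis
    obtain a a' where a: "a \<in> V - W" "a' \<in> V - W" "a \<noteq> a'"
    proof -
      obtain T where "T \<subseteq> V - W" "card T = 2" using obtain_subset_with_card_n[OF 3] by metis
      then show thesis using that by (auto simp: card_2_iff)
    qed
    let ?b = "\<sigma> a" and ?b' = "\<sigma> a'"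
    have b: "?b \<in> W - V" using \<sigma>(4)[OF a(1)] .
    let ?X0 = "insert ?b (V - {a})"
    have cX0: "card ?X0 = k" using a b cV k_pos by (simp add: card_Diff_singleton)
    have VX0: "card (V \<inter> W) < card (V \<inter> ?X0)"
    proof -
      have "V \<inter> ?X0 = V - {a}" using b by auto
      then show ?thesis using int_lt a cV by (simp add: card_Diff_singleton)
    qed
    show ?thesis
    proof (cases "\<exists>c. Suc c < k \<and> g (Suc c) \<noteq> g c")
      case False
      have lin: "g j = g 0" if "j < k" for j
        using that
      proof (induction j)
        case (Suc j)
        then have "g (Suc j) = g j" using False by blast
        with Suc show ?case by simp
      qed simp
      \<comment> \<open>Affine case: \<open>?X0\<close> and \<open>?W'\<close> both share more
        candidates with \<open>V\<close> than \<open>W\<close> does, so by induction neither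
        outscores \<open>V\<close>. As their scores add up to those of \<open>V\<close> and
        \<open>W\<close>, the committee \<open>W\<close> cannot outscore \<open>V\<close>
        either.\<close>
      let ?W' = "insert a (W - {?b})"
      have "V \<inter> ?W' = insert a (V \<inter> W)" using a b by auto
      then have "card (V \<inter> W) < card (V \<inter> ?W')" using a by simp
      moreover have "card ?W' = k" using a b cW k_pos by (simp add: card_Diff_singleton)
      ultimately have "S v ?W' \<le> S v V" using IH Vv by blast
      moreover have "S v ?X0 \<le> S v V" using IH[OF VX0 Vv cX0] .
      moreover have "S v ?X0 + S v ?W' = S v V + S v W"
        by (rule exchange_identity_linear[OF lin]) (use a b cV cW in auto)
      ultimately show ?thesis by linarith
    next
      case True
      then obtain c0 where c0: "Suc c0 < k" "g (Suc c0) \<noteq> g c0" by blast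
      obtain r where r: "r \<circ> image \<sigma> = r" "S r W = S r V" "\<And>X. card X = k \<Longrightarrow> S r X \<le> S r V"
        "S r ?X0 < S r V"
        using tilting_vec_exists[OF \<sigma>(1,4) cV a cW c0] by metis
      \<comment> \<open>The committees strictly between \<open>V\<close> and \<open>W\<close>. Each
        overlaps both \<open>V\<close> and \<open>W\<close> in more candidates than these share with
        each other, so the induction hypothesis compares it with either one.\<close>
      define I where "I = {X. card X = k \<and> V \<inter> W \<subseteq> X \<and> X \<subseteq> V \<union> W \<and> X \<noteq> V \<and> X \<noteq> W}"
      have X0I: "?X0 \<in> I" using a b cX0 by (auto simp: I_def)
      have IV: "card (V \<inter> W) < card (V \<inter> X)" and IW: "card (V \<inter> W) < card (X \<inter> W)" if X: "X \<in> I" for X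
      proof -
        have "V \<inter> W \<subset> V \<inter> X"
        proof -
          have "V \<inter> W \<noteq> V \<inter> X"
          proof
            assume "V \<inter> W = V \<inter> X"
            then have "X \<subseteq> W" using X by (auto simp: I_def)
            then have "X = W" using X cW by (intro card_subset_eq) (auto simp: I_def)
            then show False using X by (simp add: I_def)
          qed
          then show ?thesis using X by (auto simp: I_def)
        qed
        then show "card (V \<inter> W) < card (V \<inter> X)" by (intro psubset_card_mono) auto
        have "V \<inter> W \<subset> X \<inter> W"
        proof -
          have "V \<inter> W \<noteq> X \<inter> W"
          proof
            assume "V \<inter> W = X \<inter> W"
            then have "X \<subseteq> V" using X by (auto simp: I_def)
            then have "X = V" using X cV by (intro card_subset_eq) (auto simp: I_def)
            then show False using X by (simp add: I_def)
          qed
          then show ?thesis using X by (auto simp: I_def)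
        qed
        then show "card (V \<inter> W) < card (X \<inter> W)" by (intro psubset_card_mono) auto
      qed
      show ?thesis
      proof (rule ccontr)
        assume "\<not> ?thesis"
        then have D: "0 < S v W - S v V" by simp
        have hI: "S v X - S v V \<le> 0" if "X \<in> I" for X
          using IH[OF IV[OF that] Vv] that by (simp add: I_def)
        have rI: "0 \<le> S r V - S r X" if "X \<in> I" for X using r(3)[of X] that by (simp add: I_def)
        have r0: "0 < S r V - S r ?X0" using r(4) by simp
        \<comment> \<open>For the scores at \<open>n v - m r\<close>, some intermediate committee
          now beats \<open>V\<close>, while \<open>W\<close> still beats all of them, because
          \<open>r\<close> has equal scores at \<open>V\<close> and \<open>W\<close>.\<close>
        obtain n m :: nat where nm: "1 \<le> n"
          "\<exists>X\<in>I. 0 < real n * (S v X - S v V) + real m * (S r V - S r X)"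
          "\<And>X. X \<in> I \<Longrightarrow> real n * (S v X - S v V) + real m * (S r V - S r X) < real n * (S v W - S v V)"
          using rational_crossing[of I "\<lambda>X. S v X - S v V" "\<lambda>X. S r V - S r X", OF finite hI rI X0I r0 D]
          by blast
        define p where "p = interval_vec (V \<inter> W) (V \<union> W)"
        have Fp: "F p = {X \<in> committees k. V \<inter> W \<subseteq> X \<and> X \<subseteq> V \<union> W}"
          unfolding p_def by (rule F_interval_vec[of _ V]) (use cV in auto)
        have Fp_in: "V \<in> F p" "W \<in> F p" "X \<in> I \<Longrightarrow> X \<in> F p" for X
          unfolding Fp using cV cW by (auto simp: I_def committees_def)
        \<comment> \<open>Both committees win at \<open>p\<close>, so the induction hypothesis
          applies in both directions. Thus adding copies of \<open>p\<close> confines the winners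
          without affecting any comparison made below.\<close>
        have pV: "S p X = S p V" if "X \<in> I" for X
        proof (rule antisym)
          show "S p X \<le> S p V" using IH[OF IV[OF that] Fp_in(1)] that by (simp add: I_def)
          show "S p V \<le> S p X" using IH[of X V p] IV[OF that] Fp_in(3)[OF that] cV by (simp add: Int_commute)
        qed
        have pW: "S p X = S p W" if "X \<in> I" for X
        proof (rule antisym)
          show "S p W \<le> S p X" using IH[OF IW[OF that] Fp_in(3)[OF that] cW] .
          show "S p X \<le> S p W" using IH[of W X p] IW[OF that] Fp_in(2) that by (simp add: Int_commute I_def)
        qed
        define w where "w = of_nat n * v - of_nat m * r"
        obtain N where N: "N \<ge> 1" "F (of_nat N * p + w) \<subseteq> F p" using cont by blast
        define z where "z = of_nat N * p + w"
        have Sz: "S z X = real N * S p X + real n * S v X - real m * S r X" for X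
          by (simp only: z_def w_def score_add score_diff score_of_nat)
        \<comment> \<open>Every competitor of \<open>W\<close> in the interval is excluded by a
          comparison within reach of the induction: \<open>X\<close> loses against \<open>W\<close>,
          and \<open>V\<close> loses against some \<open>X\<close>.\<close>
        have "X \<notin> F z" if X: "X \<in> I" for X
        proof
          assume "X \<in> F z"
          from IH[OF IW[OF X] this cW] have "S z W \<le> S z X" .
          then show False using nm(3)[OF X] pW[OF X] r(2) by (simp add: Sz algebra_simps)
        qed
        moreover have "V \<notin> F z"
        proof
          assume Vz: "V \<in> F z"
          obtain X where X: "X \<in> I" "0 < real n * (S v X - S v V) + real m * (S r V - S r X)"
            using nm(2) by blast
          have "S z X \<le> S z V" using IH[OF IV[OF X(1)] Vz] X(1) by (simp add: I_def)
          then show False using X(2) pV[OF X(1)] by (simp add: Sz algebra_simps)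
        qed
        moreover have "F z \<subseteq> insert V (insert W I)"
          using N(2) Fp committee by (auto simp: z_def[symmetric] I_def committees_def)
        ultimately have Fz: "F z = {W}" using nonempty[of z] by blast
        have bij: "bij \<sigma>" using \<sigma>(1) by (rule involuntory_imp_bij)
        have invol: "\<sigma> ` \<sigma> ` X = X" for X by (simp add: image_image \<sigma>(1))
        have Fzs: "F (z \<circ> image \<sigma>) = {V}"
        proof -
          have "X \<in> F (z \<circ> image \<sigma>) \<longleftrightarrow> X = V" for X
            using neut[OF bij, of X z] Fz \<sigma>(3) invol by (metis singleton_iff)
          then show ?thesis by blast
        qed
        \<comment> \<open>\<open>V\<close> wins at \<open>y\<close> and is the only winner at the
          image of \<open>z\<close>, hence at their sum. Since \<open>z\<close> is
          \<open>y - m r\<close> with \<open>r\<close> invariant, this sum equals \<open>y\<close>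
          plus the image of \<open>y\<close> minus \<open>m r\<close>, which is invariant. So
          \<open>W\<close> would have to win there along with \<open>V\<close>.\<close>
        define y where "y = of_nat n * v + of_nat N * p"
        have "V \<in> F (of_nat n * v)" "V \<in> F (of_nat N * p)"
          using F_scale[OF nm(1), of v] F_scale[OF N(1), of p] Vv Fp_in by auto
        then have "V \<in> F y" unfolding y_def by (rule add_in)
        then have Fyz: "F (y + (z \<circ> image \<sigma>)) = {V}"
          using add_eq[of V y "z \<circ> image \<sigma>"] Fzs by auto
        have zy: "z = y - of_nat m * r" by (simp add: z_def w_def y_def algebra_simps)
        have rs: "r (\<sigma> ` X) = r X" for X using r(1) by (metis o_apply)
        have "(y + (z \<circ> image \<sigma>)) \<circ> image \<sigma> = y + (z \<circ> image \<sigma>)"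
          by (simp add: fun_eq_iff zy invol rs)
        then have "W \<in> F (y + (z \<circ> image \<sigma>))"
          using neut[OF bij, of V "y + (z \<circ> image \<sigma>)"] Fyz \<sigma>(2) by simp
        then show False using Fyz a by auto
      qed
    qed
  qed
qed

text \<open>Replacing \<open>x\<close> in \<open>Y\<close> by some \<open>b \<in> X - Y\<close>
  gives a neighbour \<open>X'\<close> of \<open>Y\<close>, for which the strict inequality is known.
  Both \<open>X\<close> and \<open>X'\<close> avoid \<open>x\<close>, so they win together at the
  negative vector and have equal scores.\<close>

lemma S_incl_vec_less:
  assumes "card X = k" "card Y = k" "x \<in> Y" "x \<notin> X"
  shows "S (incl_vec l x) X < S (incl_vec l x) Y"
proof -
  have "\<not> X \<subseteq> Y" using assms by (metis card_subset_eq finite)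
  then obtain b where b: "b \<in> X" "b \<notin> Y" by blast
  define C where "C = Y - {x}"
  have C: "card C = k - 1" "x \<notin> C" "b \<notin> C" "x \<noteq> b" "Y = insert x C"
    using assms b by (auto simp: C_def card_Diff_singleton)
  define X' where "X' = insert b C"
  have X': "card X' = k" "x \<notin> X'" using C k_pos by (auto simp: X'_def)
  have "S (incl_vec l x) X' < S (incl_vec l x) Y" unfolding X'_def using incl_less[OF C(1-4)] C(5) by simp
  moreover have "X' \<in> F (- incl_vec l x)" "X \<in> F (- incl_vec l x)"
    using assms X' by (auto simp: F_excl committees_def)
  then have "S (- incl_vec l x) X = S (- incl_vec l x) X'"
    using F_maximises assms X' by (metis antisym)
  ultimately show ?thesis by (simp add: score_uminus)
qed

text \<open>For the converse inclusion, a maximiser \<open>W\<close> at \<open>v\<close> is made the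
  unique one by adding \<open>w\<close>, the sum of \<open>incl_vec l x\<close> over its members, to
  a multiple of \<open>v\<close>. As winners are maximisers, \<open>W\<close> wins at the perturbed
  vector, and continuity brings it back to \<open>v\<close>.\<close>

lemma F_eq_maximisers:
  "F v = {W \<in> committees k. \<forall>W'\<in>committees k. S v W' \<le> S v W}"
proof
  show "F v \<subseteq> {W \<in> committees k. \<forall>W'\<in>committees k. S v W' \<le> S v W}"
    using F_maximises committee by (auto simp: committees_def)
  show "{W \<in> committees k. \<forall>W'\<in>committees k. S v W' \<le> S v W} \<subseteq> F v"
  proof clarify
    fix W assume W: "W \<in> committees k" "\<forall>W'\<in>committees k. S v W' \<le> S v W"
    define w where "w = (\<Sum>x\<in>W. incl_vec l x)"
    obtain n where n: "n \<ge> 1" "F (of_nat n * v + w) \<subseteq> F v" using cont by blast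
    obtain X where X: "X \<in> F (of_nat n * v + w)" using nonempty by blast
    have cX: "card X = k" using committee[OF X] .
    have cW: "card W = k" using W(1) by (simp add: committees_def)
    have "X = W"
    proof (rule ccontr)
      assume "X \<noteq> W"
      have le: "S (incl_vec l x) X \<le> S (incl_vec l x) W" if "x \<in> W" for x
        using F_maximises[of W "incl_vec l x" X] that cW cX by (simp add: F_incl committees_def)
      have "\<not> W \<subseteq> X" using \<open>X \<noteq> W\<close> cW cX by (metis card_subset_eq finite)
      then obtain x where "x \<in> W" "x \<notin> X" by blast
      then have "S w X < S w W" unfolding w_def score_sum
        using le S_incl_vec_less[OF cX cW] by (intro sum_strict_mono_ex1) auto
      moreover have "real n * S v X \<le> real n * S v W"
        using W(2) cX by (intro mult_left_mono) (auto simp: committees_def)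
      moreover have "S (of_nat n * v + w) W \<le> S (of_nat n * v + w) X" using F_maximises[OF X cW] .
      ultimately show False by (simp only: score_add score_of_nat)
    qed
    then show "W \<in> F v" using X n(2) by blast
  qed
qed

end

section \<open>The scoring function of an arbitrary vector rule\<close>

context vector_rule
begin

theorem scoring_rule:
  obtains s :: "nat \<Rightarrow> real" where "s 0 = 0" "mono s"
    "\<And>v. F v = {W \<in> committees k. \<forall>W'\<in>committees k. score s v W' \<le> score s v W}"
proof (cases nontrivial)
  case False
  \<comment> \<open>A rule that always elects every committee is given by the zero scoring
    function.\<close>
  show thesis
    by (rule that[of "\<lambda>_. 0"]) (use False in \<open>auto simp: nontrivial_def score_def mono_def\<close>)
next
  case True
  obtain l where l: "\<And>x. F (- incl_vec l x) = {W \<in> committees k. x \<notin> W}"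
    "\<And>x. F (incl_vec l x) = {W \<in> committees k. x \<in> W}" using F_incl_vec[OF True] by blast
  interpret nontrivial_vector_rule k F l by unfold_locales (rule l)+
  show thesis
  proof (rule local_scoring)
    fix g :: "nat \<Rightarrow> real"
    assume g: "\<And>j. 0 \<le> g j"
      and le: "\<And>C a b v. card C = k - 1 \<Longrightarrow> a \<notin> C \<Longrightarrow> b \<notin> C \<Longrightarrow> a \<noteq> b \<Longrightarrow> insert a C \<in> F v \<Longrightarrow>
        score (\<lambda>n. \<Sum>j<n. g j) v (insert b C) \<le> score (\<lambda>n. \<Sum>j<n. g j) v (insert a C)"
      and less: "\<And>C a b. card C = k - 1 \<Longrightarrow> a \<notin> C \<Longrightarrow> b \<notin> C \<Longrightarrow> a \<noteq> b \<Longrightarrow>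
        score (\<lambda>n. \<Sum>j<n. g j) (incl_vec l a) (insert b C) < score (\<lambda>n. \<Sum>j<n. g j) (incl_vec l a) (insert a C)"
    interpret locally_scored_rule k F l g by unfold_locales (rule le less; assumption)+
    show thesis
    proof (rule that[of "\<lambda>n. \<Sum>j<n. g j"])
      show "mono (\<lambda>n. \<Sum>j<n. g j)" using g by (intro monoI sum_mono2) auto
    qed (simp, rule F_eq_maximisers)
  qed
qed

end

section \<open>From profiles to ballot vectors\<close>

text \<open>\<open>votes A {} = 0\<close>, since the set of non-voters is infinite.\<close>

definition votes :: "'c profile \<Rightarrow> 'c set \<Rightarrow> nat" where
  "votes A B = card {i. A i = B}"

lemma finite_voters: "is_profile A \<Longrightarrow> B \<noteq> {} \<Longrightarrow> finite {i. A i = B}"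
  by (rule finite_subset[of _ "electorate A"]) (auto simp: is_profile_def electorate_def)

lemma electorate_add: "electorate (add_profiles A B) = electorate A \<union> electorate B"
  by (auto simp: electorate_def add_profiles_def)

lemma is_profile_add: "is_profile A \<Longrightarrow> is_profile B \<Longrightarrow> is_profile (add_profiles A B)"
  by (auto simp: is_profile_def electorate_add)

lemma votes_add:
  assumes "is_profile A" "is_profile B" "disjoint_profiles A B" "X \<noteq> {}"
  shows "votes (add_profiles A B) X = votes A X + votes B X"
proof -
  have dis: "A i = {} \<or> B i = {}" for i using assms(3) by (auto simp: disjoint_profiles_def electorate_def)
  have "{i. add_profiles A B i = X} = {i. A i = X} \<union> {i. B i = X}"
    using dis assms(4) by (force simp: add_profiles_def)
  moreover have "{i. A i = X} \<inter> {i. B i = X} = {}" using dis assms(4) by auto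
  ultimately show ?thesis unfolding votes_def
    using card_Un_disjoint[OF finite_voters[OF assms(1,4)] finite_voters[OF assms(2,4)]] by simp
qed

lemma votes_image:
  assumes "bij \<tau>"
  shows "votes (\<lambda>i. \<tau> ` A i) (\<tau> ` B) = votes A B"
  using assms by (simp add: votes_def inj_image_eq_iff bij_is_inj)

lemma electorate_image: "electorate (\<lambda>i. \<tau> ` A i) = electorate A"
  by (auto simp: electorate_def)

lemma is_profile_image: "is_profile (\<lambda>i. \<tau> ` A i) = is_profile A"
  by (simp add: is_profile_def electorate_image)

lemma votes_copies:
  assumes A: "is_profile A" and B: "copies_of lam A B" and X: "X \<noteq> {}"
  shows "votes B X = lam * votes A X"
proof -
  obtain h where h: "\<And>j. j < lam \<Longrightarrow> inj_on (h j) (electorate A)"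
    "\<And>j j'. j < lam \<Longrightarrow> j' < lam \<Longrightarrow> j \<noteq> j' \<Longrightarrow> h j ` electorate A \<inter> h j' ` electorate A = {}"
    "electorate B = (\<Union>j<lam. h j ` electorate A)"
    "\<And>j i. j < lam \<Longrightarrow> i \<in> electorate A \<Longrightarrow> B (h j i) = A i"
    using B unfolding copies_of_def by metis
  let ?X = "{i. A i = X}"
  have XE: "?X \<subseteq> electorate A" using X by (auto simp: electorate_def)
  have "{x. B x = X} = (\<Union>j<lam. h j ` ?X)"
  proof (intro equalityI subsetI)
    fix x assume x: "x \<in> {x. B x = X}"
    then have "x \<in> electorate B" using X by (auto simp: electorate_def)
    then obtain j i where ji: "j < lam" "i \<in> electorate A" "x = h j i" using h(3) by auto
    then have "A i = X" using h(4) x by auto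
    then show "x \<in> (\<Union>j<lam. h j ` ?X)" using ji by auto
  next
    fix x assume "x \<in> (\<Union>j<lam. h j ` ?X)"
    then obtain j i where "j < lam" "i \<in> ?X" "x = h j i" by auto
    then show "x \<in> {x. B x = X}" using h(4) XE by auto
  qed
  moreover have "card (\<Union>j<lam. h j ` ?X) = (\<Sum>j<lam. card (h j ` ?X))"
  proof (rule card_UN_disjoint)
    show "\<forall>i\<in>{..<lam}. \<forall>j\<in>{..<lam}. i \<noteq> j \<longrightarrow> h i ` ?X \<inter> h j ` ?X = {}"
      using h(2) XE by blast
  qed (use finite_voters[OF A X] in auto)
  moreover have "(\<Sum>j<lam. card (h j ` ?X)) = (\<Sum>j<lam. card ?X)"
    by (intro sum.cong refl card_image inj_on_subset[OF h(1) XE]) auto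
  ultimately show ?thesis by (simp add: votes_def)
qed

lemma copies_exist:
  assumes A: "is_profile A" and E: "finite E" and lam: "1 \<le> lam"
  obtains B where "is_profile B" "copies_of lam A B" "electorate B \<inter> E = {}"
proof -
  obtain M where M: "\<And>x. x \<in> electorate A \<union> E \<Longrightarrow> x < M" and M0: "0 < M"
  proof -
    have "finite (electorate A \<union> E)" using A E by (simp add: is_profile_def)
    then have "x < Suc (Max (electorate A \<union> E))" if "x \<in> electorate A \<union> E" for x
      using that by (simp add: le_imp_less_Suc)
    then show thesis using that[of "Suc (Max (electorate A \<union> E))"] by blast
  qed
  \<comment> \<open>Copy \<open>j\<close> occupies the block of length \<open>M\<close> starting at
    \<open>M * (j + 1)\<close>. As \<open>M\<close> exceeds all voters in
    \<open>electorate A\<close> and \<open>E\<close>, division by \<open>M\<close> recovers the copy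
    and the voter; starting with the second block avoids \<open>E\<close> and 0.\<close>
  define h where "h j i = M * Suc j + i" for j i :: nat
  define B where "B x = (if M \<le> x \<and> x < M * Suc lam then A (x mod M) else {})" for x
  have hA: "h j i div M = Suc j" "h j i mod M = i" if "i \<in> electorate A" for j i
    using M[of i] that by (simp_all add: h_def del: mult_Suc_right)
  have Bh: "B (h j i) = A i" if "j < lam" "i \<in> electorate A" for j i
  proof -
    have "M * Suc j + i < M * Suc (Suc j)" using M[of i] that by simp
    also have "\<dots> \<le> M * Suc lam" using that by (intro mult_le_mono2) simp
    finally have "h j i < M * Suc lam" by (simp add: h_def)
    moreover have "M \<le> h j i" by (simp add: h_def)
    ultimately show ?thesis using hA[OF that(2)] by (simp add: B_def)
  qed
  have EB: "electorate B = (\<Union>j<lam. h j ` electorate A)"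
  proof (intro equalityI subsetI)
    fix x assume "x \<in> electorate B"
    then have x: "M \<le> x" "x < M * Suc lam" "A (x mod M) \<noteq> {}" by (auto simp: electorate_def B_def split: if_splits)
    have "x div M \<noteq> 0" using x(1) M0 by (simp add: div_eq_0_iff)
    then have xx: "Suc (x div M - 1) = x div M" by simp
    have "x div M < Suc lam" using x(2) by (simp add: less_mult_imp_div_less mult.commute)
    then have "x div M - 1 < lam" using xx by linarith
    moreover have "x = h (x div M - 1) (x mod M)" unfolding h_def xx by simp
    ultimately show "x \<in> (\<Union>j<lam. h j ` electorate A)" using x(3) by (auto simp: electorate_def)
  next
    fix x assume "x \<in> (\<Union>j<lam. h j ` electorate A)"
    then show "x \<in> electorate B" using Bh by (force simp: electorate_def)
  qed
  show thesis
  proof (rule that[of B])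
    have "M \<le> x" if "x \<in> electorate B" for x using that by (auto simp: electorate_def B_def split: if_splits)
    then have "x \<notin> E" if "x \<in> electorate B" for x using that M[of x] by (meson UnI2 leD)
    then show "electorate B \<inter> E = {}" by blast
    show "copies_of lam A B" unfolding copies_of_def
    proof (intro exI[of _ h] conjI allI impI ballI)
      fix j :: nat show "inj_on (h j) (electorate A)" by (auto simp: inj_on_def h_def)
    next
      fix j j' :: nat assume "j \<noteq> j'"
      show "h j ` electorate A \<inter> h j' ` electorate A = {}"
      proof -
        have "h j i \<noteq> h j' i'" if "i \<in> electorate A" "i' \<in> electorate A" for i i'
          using hA(1)[OF that(1), of j] hA(1)[OF that(2), of j'] \<open>j \<noteq> j'\<close> by auto
        then show ?thesis by blast
      qed
    next
      show "electorate B = (\<Union>j<lam. h j ` electorate A)" by (rule EB)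
    next
      fix j i :: nat assume "j < lam" "i \<in> electorate A"
      then show "B (h j i) = A i" by (rule Bh)
    qed
    have "0 \<notin> electorate B" using M0 by (auto simp: electorate_def B_def)
    moreover have "h 0 ` electorate A \<subseteq> electorate B" using lam unfolding EB by (intro UN_upper) simp
    then have "electorate B \<noteq> {}" using A by (auto simp: is_profile_def)
    moreover have "finite (electorate B)" using A unfolding EB by (auto simp: is_profile_def)
    ultimately show "is_profile B" by (simp add: is_profile_def)
  qed
qed

lemma profile_with_votes:
  fixes c :: "'c::finite set \<Rightarrow> nat"
  assumes E: "finite E" and c: "B0 \<noteq> {}" "0 < c B0"
  obtains A where "is_profile A" "electorate A \<inter> E = {}" "\<And>B. B \<noteq> {} \<Longrightarrow> votes A B = c B"
proof -
  define M where "M = (\<Sum>B\<in>- {{}}. replicate_mset (c B) B)"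
  have cM: "count M B = (if B = {} then 0 else c B)" for B
    by (simp add: M_def count_sum sum.delta')
  obtain xs where xs: "mset xs = M" using ex_mset by blast
  have ne: "{} \<notin> set xs" using cM[of "{}"] xs by (metis count_eq_zero_iff set_mset_mset)
  \<comment> \<open>The ballots in the list \<open>xs\<close> go to consecutive voters from
    \<open>N\<close> on. Inserting 0 keeps \<open>Max\<close> meaningful for empty \<open>E\<close>,
    and the successor avoids voter 0.\<close>
  define N where "N = Suc (Max (insert 0 E))"
  have N: "x < N" if "x \<in> insert 0 E" for x using that E by (simp add: N_def le_imp_less_Suc)
  define A where "A i = (if N \<le> i \<and> i < N + length xs then xs ! (i - N) else {})" for i
  have voters: "{i. A i = B} = (\<lambda>j. N + j) ` {j. j < length xs \<and> xs ! j = B}" if "B \<noteq> {}" for B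
  proof (intro equalityI subsetI)
    fix i assume "i \<in> {i. A i = B}"
    then have "N \<le> i" "i < N + length xs" "xs ! (i - N) = B" using that by (auto simp: A_def split: if_splits)
    then show "i \<in> (\<lambda>j. N + j) ` {j. j < length xs \<and> xs ! j = B}" by (intro image_eqI[of _ _ "i - N"]) auto
  qed (auto simp: A_def)
  have v: "votes A B = c B" if "B \<noteq> {}" for B
  proof -
    have "votes A B = card {j. j < length xs \<and> xs ! j = B}"
      unfolding votes_def voters[OF that] by (rule card_image) simp
    also have "\<dots> = count (mset xs) B" by (simp add: count_mset count_list_eq_length_filter length_filter_conv_card eq_commute)
    finally show ?thesis using xs cM that by simp
  qed
  have low: "N \<le> i" "i < N + length xs" if "i \<in> electorate A" for i
    using that by (auto simp: electorate_def A_def split: if_splits)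
  show thesis
  proof (rule that[of A])
    have out: "i \<notin> insert 0 E" if "i \<in> electorate A" for i using low(1)[OF that] N[of i] by (meson leD)
    then show "electorate A \<inter> E = {}" by blast
    have "electorate A \<subseteq> {..<N + length xs}" using low(2) by (intro subsetI) simp
    then have "finite (electorate A)" by (rule finite_subset) simp
    moreover have "0 \<notin> electorate A" using out by blast
    moreover have "{i. A i = B0} \<noteq> {}" using v[OF c(1)] c(2) by (intro notI) (simp add: votes_def)
    then have "electorate A \<noteq> {}" using c(1) by (auto simp: electorate_def)
    ultimately show "is_profile A" by (simp add: is_profile_def)
  qed (rule v)
qed

lemma card_electorate:
  fixes A :: "'c::finite profile"
  assumes "is_profile A"
  shows "card (electorate A) = (\<Sum>B\<in>- {{}}. votes A B)"
proof -
  have "electorate A = (\<Union>B\<in>- {{}}. {i. A i = B})" by (auto simp: electorate_def)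
  also have "card \<dots> = (\<Sum>B\<in>- {{}}. card {i. A i = B})"
    by (rule card_UN_disjoint) (use finite_voters[OF assms] in auto)
  finally show ?thesis by (simp add: votes_def)
qed

lemma thiele_score_votes:
  fixes A :: "'c::finite profile"
  assumes "is_profile A" "s 0 = 0"
  shows "thiele_score s A W = score s (\<lambda>B. int (votes A B)) W"
proof -
  have fin: "finite (electorate A)" using assms(1) by (simp add: is_profile_def)
  have "thiele_score s A W = (\<Sum>B\<in>UNIV. \<Sum>i\<in>{i. i \<in> electorate A \<and> A i = B}. s (card (A i \<inter> W)))"
    unfolding thiele_score_def by (rule sum.group[symmetric]) (use fin in auto)
  also have "\<dots> = score s (\<lambda>B. int (votes A B)) W"
    unfolding score_def
  proof (intro sum.cong refl)
    fix B
    show "(\<Sum>i\<in>{i. i \<in> electorate A \<and> A i = B}. s (card (A i \<inter> W))) = real_of_int (int (votes A B)) * s (card (B \<inter> W))"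
    proof (cases "B = {}")
      case True
      then have "{i. i \<in> electorate A \<and> A i = B} = {}" by (auto simp: electorate_def)
      then show ?thesis using True assms(2) by simp
    next
      case False
      then have "{i. i \<in> electorate A \<and> A i = B} = {i. A i = B}" by (auto simp: electorate_def)
      then show ?thesis by (simp add: votes_def)
    qed
  qed
  finally show ?thesis .
qed

text \<open>On the union of the two electorates both profiles have the same multiset of ballots. For
  the empty set this holds because the electorates have equal size. Hence a permutation of the union
  carries one profile to the other, and it fixes 0, which lies in neither electorate.\<close>

lemma anonymous_votes:
  fixes A A' :: "'c::finite profile"
  assumes "anonymous f" and A: "is_profile A" and A': "is_profile A'"
    and v: "\<And>B. B \<noteq> {} \<Longrightarrow> votes A B = votes A' B"
  shows "f A = f A'"
proof -
  let ?S = "electorate A \<union> electorate A'"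
  have fin: "finite ?S" using A A' by (simp add: is_profile_def)
  have "card (electorate A) = card (electorate A')"
    using v unfolding card_electorate[OF A] card_electorate[OF A'] by simp
  moreover have "{i \<in> ?S. A i = {}} = ?S - electorate A" "{i \<in> ?S. A' i = {}} = ?S - electorate A'"
    by (auto simp: electorate_def)
  ultimately have e: "card {i \<in> ?S. A i = {}} = card {i \<in> ?S. A' i = {}}"
    using fin by (simp add: card_Diff_subset)
  have "image_mset A (mset_set ?S) = image_mset A' (mset_set ?S)"
  proof (rule multiset_eqI)
    fix B
    have "{i \<in> ?S. A i = B} = {i. A i = B}" "{i \<in> ?S. A' i = B} = {i. A' i = B}" if "B \<noteq> {}"
      using that by (auto simp: electorate_def)
    then have "card {i \<in> ?S. A i = B} = card {i \<in> ?S. A' i = B}"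
      using e v[of B] by (cases "B = {}") (auto simp: votes_def)
    then show "count (image_mset A (mset_set ?S)) B = count (image_mset A' (mset_set ?S)) B"
      using fin by (simp add: count_image_mset_eq_card_vimage)
  qed
  then obtain p where p: "p permutes ?S" "\<forall>x\<in>?S. A x = A' (p x)"
    using image_mset_eq_implies_permutes[OF fin] by metis
  have Ap: "A x = A' (p x)" for x
  proof (cases "x \<in> ?S")
    case False
    then show ?thesis using p(1) by (auto simp: permutes_not_in electorate_def)
  qed (use p in blast)
  have "bij p" using p(1) by (rule permutes_bij)
  moreover have "p 0 = 0" using p(1) A A' by (intro permutes_not_in) (auto simp: is_profile_def)
  ultimately have "f A = f (A \<circ> inv p)" using assms(1) A unfolding anonymous_def by blast
  moreover have "A \<circ> inv p = A'" using Ap p(1) by (simp add: fun_eq_iff permutes_inverses(1))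
  ultimately show ?thesis by simp
qed

lemma bij_image_eq_committees:
  fixes F :: "'c::finite set set"
  assumes "F \<noteq> {}" "F \<subseteq> committees k" "\<And>\<tau>. bij \<tau> \<Longrightarrow> image \<tau> ` F = F"
  shows "F = committees k"
proof -
  obtain W where W: "W \<in> F" using assms(1) by blast
  have "W' \<in> F" if "card W' = k" for W'
  proof -
    have "card W = card W'" using W assms(2) that by (auto simp: committees_def)
    then obtain \<tau> where "bij \<tau>" "\<tau> ` W = W'" by (rule bij_image_card)
    then show ?thesis using assms(3)[of \<tau>] W by blast
  qed
  then show ?thesis using assms(2) by (auto simp: committees_def)
qed

lemma profile_with_constant_votes:
  assumes "finite E" "0 < d"
  obtains D :: "'c::finite profile" where "is_profile D" "electorate D \<inter> E = {}" "\<And>B. B \<noteq> {} \<Longrightarrow> votes D B = d"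
  using profile_with_votes[OF assms(1), of UNIV "\<lambda>_ :: 'c set. d"] assms(2) by blast

section \<open>The vector rule induced by a voting rule satisfying the axioms\<close>

locale axiomatic_rule =
  fixes k :: nat and f :: "'c::finite profile \<Rightarrow> 'c set set"
  assumes k_ge: "1 \<le> k" and k_lt: "k < card (UNIV :: 'c set)" and abc: "abc_rule k f"
    and anon: "anonymous f" and neutr: "neutral f" and consi: "consistent f"
    and conti: "continuous_rule f" and indepl: "indep_losers f"
begin

text \<open>Adding a constant to all entries does not change the winners, so vectors with negative
  entries are represented by profiles after a shift.\<close>

definition represents :: "'c profile \<Rightarrow> ('c set \<Rightarrow> int) \<Rightarrow> bool" where
  "represents A v \<longleftrightarrow> is_profile A \<and> (\<exists>n. \<forall>B. B \<noteq> {} \<longrightarrow> int (votes A B) = v B + n)"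

lemma representsI: "is_profile A \<Longrightarrow> (\<And>B. B \<noteq> {} \<Longrightarrow> int (votes A B) = v B + n) \<Longrightarrow> represents A v"
  unfolding represents_def by blast

lemma representsE:
  assumes "represents A v"
  obtains n where "is_profile A" "\<And>B. B \<noteq> {} \<Longrightarrow> int (votes A B) = v B + n"
  using assms unfolding represents_def by blast

text \<open>Renaming candidates preserves the vote counts, so anonymity and neutrality together make
  the set of winners invariant under all permutations.\<close>

lemma f_constant:
  assumes D: "is_profile D" "\<And>B. B \<noteq> {} \<Longrightarrow> votes D B = d"
  shows "f D = committees k"
proof (rule bij_image_eq_committees)
  show "f D \<noteq> {}" "f D \<subseteq> committees k" using abc D(1) by (auto simp: abc_rule_def)
  fix \<tau> :: "'c \<Rightarrow> 'c" assume t: "bij \<tau>"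
  have "votes (\<lambda>i. \<tau> ` D i) B = votes D B" if "B \<noteq> {}" for B
  proof -
    have "B = \<tau> ` (\<tau> -` B)" using t by (simp add: surj_image_vimage_eq bij_is_surj)
    moreover have "\<tau> -` B \<noteq> {}" using that calculation by (metis image_empty)
    ultimately show ?thesis using votes_image[OF t, of D "\<tau> -` B"] D(2) that by simp
  qed
  then have "f (\<lambda>i. \<tau> ` D i) = f D" using D(1) by (intro anonymous_votes[OF anon]) (auto simp: is_profile_image)
  moreover have "f (\<lambda>i. \<tau> ` D i) = image \<tau> ` f D" using neutr t D(1) by (simp add: neutral_def)
  ultimately show "image \<tau> ` f D = f D" by simp
qed

text \<open>The surplus is a disjoint profile with \<open>d\<close> copies of each ballot. All
  committees win there, so consistency keeps the winners of \<open>A'\<close>.\<close>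

lemma f_shift:
  assumes "is_profile A" "is_profile A'" and v: "\<And>B. B \<noteq> {} \<Longrightarrow> votes A B = votes A' B + d"
  shows "f A = f A'"
proof (cases "d = 0")
  case True
  then show ?thesis using assms by (intro anonymous_votes[OF anon]) auto
next
  case False
  then have "0 < d" by simp
  have "finite (electorate A')" using assms(2) by (simp add: is_profile_def)
  then obtain D :: "'c profile" where D: "is_profile D" "electorate D \<inter> electorate A' = {}"
    "\<And>B. B \<noteq> {} \<Longrightarrow> votes D B = d"
    using profile_with_constant_votes[OF _ \<open>0 < d\<close>] by blast
  have dis: "disjoint_profiles A' D" using D(2) by (auto simp: disjoint_profiles_def)
  have "f A' \<subseteq> committees k" "f A' \<noteq> {}" using abc assms(2) by (auto simp: abc_rule_def)
  then have "f (add_profiles A' D) = f A'"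
    using consi assms(2) D(1) dis f_constant[OF D(1,3)] by (simp add: consistent_def Int_absorb2)
  moreover have "f A = f (add_profiles A' D)"
    by (rule anonymous_votes[OF anon assms(1)])
      (use assms D dis in \<open>auto simp: is_profile_add votes_add\<close>)
  ultimately show ?thesis by simp
qed

lemma represents_unique:
  assumes "represents A v" "represents A' v"
  shows "f A = f A'"
proof -
  obtain n where n: "is_profile A" "\<And>B. B \<noteq> {} \<Longrightarrow> int (votes A B) = v B + n"
    using assms(1) by (rule representsE) blast
  obtain n' where n': "is_profile A'" "\<And>B. B \<noteq> {} \<Longrightarrow> int (votes A' B) = v B + n'"
    using assms(2) by (rule representsE) blast
  show ?thesis
  proof (cases "n' \<le> n")
    case True
    have "votes A B = votes A' B + nat (n - n')" if "B \<noteq> {}" for B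
      using n(2)[OF that] n'(2)[OF that] True by linarith
    then show ?thesis by (rule f_shift[OF n(1) n'(1)])
  next
    case False
    have "votes A' B = votes A B + nat (n' - n)" if "B \<noteq> {}" for B
      using n(2)[OF that] n'(2)[OF that] False by linarith
    then have "f A' = f A" by (rule f_shift[OF n'(1) n(1)])
    then show ?thesis by simp
  qed
qed

lemma represents_exists:
  assumes "finite E"
  obtains A where "represents A v" "electorate A \<inter> E = {}"
proof -
  \<comment> \<open>This shift makes every entry positive, so a profile with these vote counts
    exists.\<close>
  define n where "n = 1 + (\<Sum>B\<in>UNIV. \<bar>v B\<bar>)"
  have pos: "0 < v B + n" for B
  proof -
    have "\<bar>v B\<bar> \<le> (\<Sum>B\<in>UNIV. \<bar>v B\<bar>)" by (rule member_le_sum) auto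
    then show ?thesis by (simp add: n_def)
  qed
  have "(UNIV :: 'c set) \<noteq> {}" "0 < (\<lambda>B. nat (v B + n)) UNIV" using pos by auto
  then obtain A where A: "is_profile A" "electorate A \<inter> E = {}"
    "\<And>B. B \<noteq> {} \<Longrightarrow> votes A B = nat (v B + n)" using profile_with_votes[OF assms, of UNIV "\<lambda>B. nat (v B + n)"] by blast
  have "represents A v" by (rule representsI[OF A(1), of _ n]) (use A(3) pos in \<open>simp add: less_imp_le\<close>)
  then show thesis using that A(2) by blast
qed

text \<open>Some profile represents \<open>v\<close> by \<open>represents_exists\<close>, and by
  \<open>represents_unique\<close> all of them have the same winners.\<close>

definition F :: "('c set \<Rightarrow> int) \<Rightarrow> 'c set set" where
  "F v = f (SOME A. represents A v)"

lemma F_represents: "represents A v \<Longrightarrow> F v = f A"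
  unfolding F_def by (rule represents_unique[OF someI[of "\<lambda>A. represents A v"]])

lemma F_votes: "is_profile A \<Longrightarrow> f A = F (\<lambda>B. int (votes A B))"
  by (rule F_represents[symmetric]) (auto intro: representsI[of _ _ 0])

lemma represents_add:
  assumes "represents A v" "represents B w" "disjoint_profiles A B"
  shows "represents (add_profiles A B) (v + w)"
proof -
  obtain n where n: "is_profile A" "\<And>B. B \<noteq> {} \<Longrightarrow> int (votes A B) = v B + n"
    using assms(1) by (rule representsE) blast
  obtain m where m: "is_profile B" "\<And>X. X \<noteq> {} \<Longrightarrow> int (votes B X) = w X + m"
    using assms(2) by (rule representsE) blast
  show ?thesis
    by (rule representsI[of _ _ "n + m"]) (use n m assms(3) in \<open>simp_all add: is_profile_add votes_add\<close>)
qed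

lemma F_nonempty: "F v \<noteq> {}" and F_committees: "F v \<subseteq> committees k"
proof -
  obtain A where A: "represents A v" using represents_exists[of "{}"] by blast
  then have "is_profile A" by (simp add: represents_def)
  then show "F v \<noteq> {}" "F v \<subseteq> committees k" using abc F_represents[OF A] by (auto simp: abc_rule_def)
qed

lemma F_consistent:
  assumes "F v \<inter> F w \<noteq> {}"
  shows "F (v + w) = F v \<inter> F w"
proof -
  obtain A where A: "represents A v" using represents_exists[of "{}"] by blast
  then have pA: "is_profile A" by (simp add: represents_def)
  then have "finite (electorate A)" by (simp add: is_profile_def)
  then obtain B where B: "represents B w" "electorate B \<inter> electorate A = {}"
    using represents_exists by blast
  have dis: "disjoint_profiles A B" using B(2) by (auto simp: disjoint_profiles_def)
  have "is_profile B" using B(1) by (simp add: represents_def)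
  then have "f (add_profiles A B) = f A \<inter> f B"
    using consi pA dis assms F_represents[OF A] F_represents[OF B(1)] by (auto simp: consistent_def)
  then show ?thesis
    using F_represents[OF A] F_represents[OF B(1)] F_represents[OF represents_add[OF A B(1) dis]] by simp
qed

lemma F_neutral:
  assumes t: "bij \<tau>"
  shows "W \<in> F (v \<circ> image \<tau>) \<longleftrightarrow> \<tau> ` W \<in> F v"
proof -
  obtain A where A: "represents A (v \<circ> image \<tau>)" using represents_exists[of "{}"] by blast
  then obtain n where n: "is_profile A" "\<And>B. B \<noteq> {} \<Longrightarrow> int (votes A B) = (v \<circ> image \<tau>) B + n"
    by (rule representsE) blast
  have "represents (\<lambda>i. \<tau> ` A i) v"
  proof (rule representsI[of _ _ n])
    show "is_profile (\<lambda>i. \<tau> ` A i)" using n(1) by (simp add: is_profile_image)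
    fix B :: "'c set" assume "B \<noteq> {}"
    have B: "\<tau> ` (\<tau> -` B) = B" using t by (simp add: surj_image_vimage_eq bij_is_surj)
    then have "\<tau> -` B \<noteq> {}" using \<open>B \<noteq> {}\<close> by (metis image_empty)
    from n(2)[OF this] votes_image[OF t, of A "\<tau> -` B"] B
    show "int (votes (\<lambda>i. \<tau> ` A i) B) = v B + n" by simp
  qed
  then have "F v = f (\<lambda>i. \<tau> ` A i)" by (rule F_represents)
  also have "\<dots> = image \<tau> ` f A" using neutr t n(1) by (simp add: neutral_def)
  finally have "F v = image \<tau> ` F (v \<circ> image \<tau>)" using F_represents[OF A] by simp
  moreover have "inj (image \<tau>)" by (intro injI) (simp add: inj_image_eq_iff[OF bij_is_inj[OF t]])
  ultimately show ?thesis by (simp add: inj_image_mem_iff)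
qed

lemma F_continuous: "\<exists>n\<ge>1. F (of_nat n * v + w) \<subseteq> F v"
proof -
  obtain A where A: "represents A v" using represents_exists[of "{}"] by blast
  obtain A' where A': "represents A' w" using represents_exists[of "{}"] by blast
  obtain n where n: "is_profile A" "\<And>B. B \<noteq> {} \<Longrightarrow> int (votes A B) = v B + n"
    using A by (rule representsE) blast
  have pA': "is_profile A'" using A' by (simp add: represents_def)
  then obtain lam where lam: "lam \<ge> 1" "\<And>B. is_profile B \<Longrightarrow> copies_of lam A B \<Longrightarrow> disjoint_profiles B A' \<Longrightarrow>
         f (add_profiles B A') \<subseteq> f A"
    using conti n(1) unfolding continuous_rule_def by blast
  have "finite (electorate A')" using pA' by (simp add: is_profile_def)
  then obtain B where B: "is_profile B" "copies_of lam A B" "electorate B \<inter> electorate A' = {}"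
    by (rule copies_exist[OF n(1) _ lam(1)])
  have dis: "disjoint_profiles B A'" using B(3) by (simp add: disjoint_profiles_def)
  have "represents B (of_nat lam * v)"
    by (rule representsI[OF B(1), of _ "int lam * n"])
      (use n(2) votes_copies[OF n(1) B(2)] in \<open>simp add: algebra_simps\<close>)
  from F_represents[OF represents_add[OF this A' dis]] lam(2)[OF B(1,2) dis]
  have "F (of_nat lam * v + w) \<subseteq> F v" using F_represents[OF A] by simp
  then show ?thesis using lam(1) by blast
qed

text \<open>In the profile \<open>D\<close> each ballot occurs once and every committee wins.
  Shrinking the ballot of the only voter with \<open>A\<close> to \<open>A'\<close> keeps
  \<open>W\<close> winning, and the result represents the vector up to the shift 1.\<close>

lemma F_indep:
  assumes "A' \<noteq> {}" "A' \<subseteq> A" "W \<inter> A' = W \<inter> A" "card W = k"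
  shows "W \<in> F (single A' - single A)"
proof -
  obtain D :: "'c profile" where D: "is_profile D" "\<And>B. B \<noteq> {} \<Longrightarrow> votes D B = 1"
    using profile_with_constant_votes[OF finite.emptyI zero_less_one, where ?'c = 'c] by blast
  have "A \<noteq> {}" using assms by auto
  then obtain i where i: "{j. D j = A} = {i}" using D(2)[of A] by (auto simp: votes_def card_1_singleton_iff)
  then have Di: "D i = A" "\<And>j. D j = A \<Longrightarrow> j = i" by auto
  define D' where "D' = D(i := A')"
  have el: "electorate D' = electorate D" using Di(1) \<open>A \<noteq> {}\<close> assms(1) by (auto simp: electorate_def D'_def)
  then have pD': "is_profile D'" using D(1) by (simp add: is_profile_def)
  have "represents D' (single A' - single A)"
  proof (rule representsI[OF pD', of _ 1])
    fix B :: "'c set" assume B: "B \<noteq> {}"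
    have fin: "finite {j. D j = B}" by (rule finite_voters[OF D(1) B])
    have one: "card {j. D j = B} = 1" using D(2)[OF B] by (simp add: votes_def)
    consider "A' = A" | "A' \<noteq> A" "B = A'" | "A' \<noteq> A" "B = A" | "B \<noteq> A'" "B \<noteq> A" by blast
    then show "int (votes D' B) = (single A' - single A) B + 1"
    proof cases
      case 1
      then have "D' = D" using Di(1) by (auto simp: D'_def fun_eq_iff)
      then show ?thesis using 1 one by (simp add: votes_def)
    next
      case 2
      then have "{j. D' j = B} = insert i {j. D j = B}" "i \<notin> {j. D j = B}" using Di(1) by (auto simp: D'_def)
      then show ?thesis using 2 one fin by (simp add: votes_def single_apply)
    next
      case 3
      have "D' j \<noteq> A" for j using 3(1) Di(2)[of j] unfolding D'_def fun_upd_apply by metis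
      then have "{j. D' j = B} = {}" using 3(2) by simp
      then show ?thesis using 3 by (simp add: votes_def single_apply)
    next
      case 4
      then have "{j. D' j = B} = {j. D j = B}" using Di(1) by (auto simp: D'_def)
      then show ?thesis using 4 one by (simp add: votes_def single_apply)
    qed
  qed
  then have "F (single A' - single A) = f D'" by (rule F_represents)
  moreover have "W \<in> f D" using f_constant[OF D] assms(4) by (simp add: committees_def)
  moreover have "\<forall>j\<in>electorate D. D' j \<subseteq> D j \<and> W \<inter> D' j = W \<inter> D j"
    using assms Di(1) by (simp add: D'_def)
  ultimately show ?thesis using indepl D(1) pD' el unfolding indep_losers_def by metis
qed

sublocale vector_rule k F
proof
  show "F v = F w" if "\<And>B. B \<noteq> {} \<Longrightarrow> v B = w B" for v w
  proof -
    have "represents A v = represents A w" for A using that by (simp add: represents_def)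
    then show ?thesis by (simp add: F_def)
  qed
  show "card W = k" if "W \<in> F v" for W v using F_committees that by (auto simp: committees_def)
qed (fact k_ge k_lt F_nonempty F_consistent F_neutral F_continuous F_indep)+

lemma thiele: "thiele_rule k f"
proof -
  obtain s :: "nat \<Rightarrow> real" where s: "s 0 = 0" "mono s"
    "\<And>v. F v = {W \<in> committees k. \<forall>W'\<in>committees k. score s v W' \<le> score s v W}"
    using scoring_rule by blast
  have "f A = {W \<in> committees k. \<forall>W'\<in>committees k. thiele_score s A W' \<le> thiele_score s A W}"
    if "is_profile A" for A
    using s(3) by (simp add: F_votes[OF that] thiele_score_votes[where s = s, OF that s(1)])
  then show ?thesis unfolding thiele_rule_def using s(1,2) by (intro exI[of _ s]) (auto simp: mono_def)
qed

end

section \<open>Thiele rules satisfy the axioms\<close>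

context
  fixes k :: nat and f :: "'c::finite profile \<Rightarrow> 'c set set" and s :: "nat \<Rightarrow> real"
  assumes s0: "s 0 = 0" and s_mono: "\<And>i j. i \<le> j \<Longrightarrow> j \<le> k \<Longrightarrow> s i \<le> s j"
    and f_eq: "\<And>A. is_profile A \<Longrightarrow> f A = {W \<in> committees k.
          \<forall>W'\<in>committees k. thiele_score s A W \<ge> thiele_score s A W'}"
begin

lemma thiele_anonymous: "anonymous f"
  unfolding anonymous_def
proof (intro allI impI)
  fix A :: "'c profile" and \<pi> :: "nat \<Rightarrow> nat" assume A: "is_profile A" and p: "bij \<pi>" "\<pi> 0 = 0"
  have el: "electorate (A \<circ> inv \<pi>) = \<pi> ` electorate A"
    using p(1) by (simp add: electorate_def bij_image_Collect_eq)
  have "\<pi> i = 0 \<longleftrightarrow> i = 0" for i using p by (metis bij_is_inj injD)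
  then have "0 \<notin> \<pi> ` electorate A" using A by (metis imageE is_profile_def)
  then have B: "is_profile (A \<circ> inv \<pi>)" using A unfolding is_profile_def el by simp
  have "thiele_score s (A \<circ> inv \<pi>) W = thiele_score s A W" for W
    unfolding thiele_score_def el using p(1)
    by (subst sum.reindex) (simp_all add: bij_is_inj inj_on_subset[OF bij_is_inj])
  then show "f A = f (A \<circ> inv \<pi>)" by (simp add: f_eq A B)
qed

lemma thiele_neutral: "neutral f"
  unfolding neutral_def
proof (intro allI impI)
  fix A :: "'c profile" and \<tau> :: "'c \<Rightarrow> 'c" assume A: "is_profile A" and t: "bij \<tau>"
  have inj: "inj \<tau>" using t by (rule bij_is_inj)
  have c: "card (\<tau> ` X) = card X" for X using inj by (meson card_image inj_on_subset subset_UNIV)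
  have sc: "thiele_score s (\<lambda>i. \<tau> ` A i) (\<tau> ` W) = thiele_score s A W" for W
    unfolding thiele_score_def electorate_image by (simp add: image_Int[OF inj, symmetric] c)
  have com: "(committees k :: 'c set set) = image \<tau> ` committees k"
  proof (intro equalityI subsetI)
    fix W :: "'c set" assume W: "W \<in> committees k"
    have "W = \<tau> ` (\<tau> -` W)" using t by (simp add: surj_image_vimage_eq bij_is_surj)
    moreover from this have "\<tau> -` W \<in> committees k" using W c by (metis committees_def mem_Collect_eq)
    ultimately show "W \<in> image \<tau> ` committees k" by blast
  qed (auto simp: committees_def c)
  have "f (\<lambda>i. \<tau> ` A i) = {W \<in> image \<tau> ` committees k.
      \<forall>W'\<in>image \<tau> ` committees k. thiele_score s (\<lambda>i. \<tau> ` A i) W \<ge> thiele_score s (\<lambda>i. \<tau> ` A i) W'}"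
    using A com by (simp add: f_eq is_profile_image)
  also have "\<dots> = image \<tau> ` f A" by (auto simp: f_eq A sc)
  finally show "f (\<lambda>i. \<tau> ` A i) = (\<lambda>W. \<tau> ` W) ` f A" .
qed

lemma thiele_score_add:
  assumes "is_profile A" "is_profile B" "disjoint_profiles A B"
  shows "thiele_score s (add_profiles A B) W = thiele_score s A W + thiele_score s B W"
proof -
  have dis: "electorate A \<inter> electorate B = {}" using assms(3) by (simp add: disjoint_profiles_def)
  have 1: "add_profiles A B i = A i" if "i \<in> electorate A" for i
    using that dis by (auto simp: add_profiles_def electorate_def)
  have 2: "add_profiles A B i = B i" if "i \<in> electorate B" for i
    using that dis by (auto simp: add_profiles_def electorate_def)
  show ?thesis unfolding thiele_score_def electorate_add
    using assms dis 1 2 by (subst sum.union_disjoint) (auto simp: is_profile_def)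
qed

text \<open>A common winner \<open>V\<close> attains both maxima at once, so a maximiser of the
  summed score must attain each maximum separately.\<close>

lemma thiele_consistent: "consistent f"
  unfolding consistent_def
proof (intro allI impI)
  fix A B :: "'c profile"
  assume A: "is_profile A" and B: "is_profile B" and dis: "disjoint_profiles A B" and ne: "f A \<inter> f B \<noteq> {}"
  obtain V where V: "V \<in> f A" "V \<in> f B" using ne by blast
  let ?a = "thiele_score s A" and ?b = "thiele_score s B"
  have VA: "?a W \<le> ?a V" "?b W \<le> ?b V" if "W \<in> committees k" for W using V A B that by (auto simp: f_eq)
  have Vk: "V \<in> committees k" using V A by (simp add: f_eq)
  have fAB: "f (add_profiles A B) = {W \<in> committees k. \<forall>W'\<in>committees k. ?a W + ?b W \<ge> ?a W' + ?b W'}"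
    using A B dis by (simp add: f_eq is_profile_add thiele_score_add)
  show "f (add_profiles A B) = f A \<inter> f B"
  proof (intro equalityI subsetI)
    fix W assume "W \<in> f (add_profiles A B)"
    then have W: "W \<in> committees k" "?a V + ?b V \<le> ?a W + ?b W" using Vk by (auto simp: fAB)
    then have "?a W = ?a V" "?b W = ?b V" using VA[OF W(1)] by linarith+
    then show "W \<in> f A \<inter> f B" using VA W(1) by (simp add: f_eq A B)
  next
    fix W assume "W \<in> f A \<inter> f B"
    then show "W \<in> f (add_profiles A B)" by (auto simp: fAB f_eq A B intro: add_mono)
  qed
qed

text \<open>A loser at \<open>A\<close> trails some committee by a positive margin, which after
  enough copies outweighs the scores in \<open>A'\<close>. With finitely many committees one
  multiple works for all losers.\<close>

lemma thiele_continuous: "continuous_rule f"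
  unfolding continuous_rule_def
proof (intro allI impI)
  fix A A' :: "'c profile" assume A: "is_profile A" and A': "is_profile A'"
  let ?a = "thiele_score s A" and ?b = "thiele_score s A'"
  have "\<forall>\<^sub>F n in sequentially. \<exists>V\<in>committees k. real n * ?a W + ?b W < real n * ?a V + ?b V"
    if W: "W \<in> committees k - f A" for W
  proof -
    obtain V where V: "V \<in> committees k" "?a W < ?a V" using W by (auto simp: f_eq A not_le)
    have "\<forall>\<^sub>F n in sequentially. (?b W - ?b V) / (?a V - ?a W) < real n"
      using eventually_gt_at_top[of "nat \<lceil>(?b W - ?b V) / (?a V - ?a W)\<rceil>"]
      by eventually_elim linarith
    then show ?thesis
    proof eventually_elim
      case (elim n)
      then have "?b W - ?b V < real n * (?a V - ?a W)" using V(2) by (simp add: field_simps)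
      then show ?case using V(1) by (intro bexI[of _ V]) (simp_all add: algebra_simps)
    qed
  qed
  then have "\<forall>\<^sub>F n in sequentially. \<forall>W\<in>committees k - f A. \<exists>V\<in>committees k. real n * ?a W + ?b W < real n * ?a V + ?b V"
    by (intro eventually_ball_finite) auto
  then have "\<forall>\<^sub>F n in sequentially. n \<ge> 1 \<and> (\<forall>W\<in>committees k - f A. \<exists>V\<in>committees k. real n * ?a W + ?b W < real n * ?a V + ?b V)"
    using eventually_ge_at_top[of 1] by eventually_elim simp
  then obtain n where n: "n \<ge> 1" "\<And>W. W \<in> committees k - f A \<Longrightarrow> \<exists>V\<in>committees k. real n * ?a W + ?b W < real n * ?a V + ?b V"
    by (auto simp: eventually_sequentially)
  show "\<exists>lam\<ge>1. \<forall>B. is_profile B \<longrightarrow> copies_of lam A B \<longrightarrow> disjoint_profiles B A' \<longrightarrow> f (add_profiles B A') \<subseteq> f A"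
  proof (intro exI[of _ n] conjI n(1) allI impI subsetI)
    fix B W assume B: "is_profile B" "copies_of n A B" "disjoint_profiles B A'" and W: "W \<in> f (add_profiles B A')"
    \<comment> \<open>The copies are compared through vote counts. At the empty set,
      \<open>s 0 = 0\<close> makes both sides vanish.\<close>
    have "score s (\<lambda>X. int (votes B X)) X = score s (of_nat n * (\<lambda>X. int (votes A X))) X" for X
      unfolding score_def
    proof (intro sum.cong refl)
      fix Y :: "'c set"
      show "real_of_int (int (votes B Y)) * s (card (Y \<inter> X)) =
        real_of_int ((of_nat n * (\<lambda>X. int (votes A X))) Y) * s (card (Y \<inter> X))"
        using votes_copies[OF A B(2), of Y] s0 by (cases "Y = {}") auto
    qed
    then have "thiele_score s B X = real n * ?a X" for X
      by (simp add: thiele_score_votes[where s = s, OF _ s0] A B(1) score_of_nat)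
    then have sc: "thiele_score s (add_profiles B A') X = real n * ?a X + ?b X" for X
      using thiele_score_add[OF B(1) A' B(3)] by simp
    have W': "W \<in> committees k" "\<forall>V\<in>committees k. real n * ?a V + ?b V \<le> real n * ?a W + ?b W"
      using W by (auto simp: f_eq is_profile_add B(1) A' sc)
    then show "W \<in> f A" using n(2)[of W] by force
  qed
qed

text \<open>The score of \<open>W\<close> is unchanged, while monotonicity of \<open>s\<close> lets
  all other scores only fall.\<close>

lemma thiele_indep_losers: "indep_losers f"
  unfolding indep_losers_def
proof (intro allI impI)
  fix A A' :: "'c profile" and W
  assume A: "is_profile A" and A': "is_profile A'" and el: "electorate A = electorate A'"
    and sub: "\<forall>i\<in>electorate A. A' i \<subseteq> A i \<and> W \<inter> A' i = W \<inter> A i" and W: "W \<in> f A"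
  have eq: "thiele_score s A' W = thiele_score s A W"
    unfolding thiele_score_def el[symmetric] using sub by (intro sum.cong) (auto simp: Int_commute)
  have le: "thiele_score s A' V \<le> thiele_score s A V" if "V \<in> committees k" for V
    unfolding thiele_score_def el[symmetric]
  proof (intro sum_mono s_mono)
    fix i assume "i \<in> electorate A"
    then show "card (A' i \<inter> V) \<le> card (A i \<inter> V)" using sub by (intro card_mono) auto
    show "card (A i \<inter> V) \<le> k" using that card_mono[of V "A i \<inter> V"] by (simp add: committees_def)
  qed
  show "W \<in> f A'" using W le eq by (fastforce simp: f_eq A A')
qed

end

theorem theorem1:
  fixes f :: "'c::finite profile \<Rightarrow> 'c set set" and k :: nat
  assumes "card (UNIV :: 'c set) \<ge> 2" and "1 \<le> k" and "k < card (UNIV :: 'c set)"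
    and "abc_rule k f"
  shows "thiele_rule k f \<longleftrightarrow>
    anonymous f \<and> neutral f \<and> consistent f \<and> continuous_rule f \<and> indep_losers f"
proof
  assume "thiele_rule k f"
  then obtain s where s: "s 0 = 0" "\<And>i j. i \<le> j \<Longrightarrow> j \<le> k \<Longrightarrow> s i \<le> s j"
    "\<And>A. is_profile A \<Longrightarrow> f A = {W \<in> committees k.
          \<forall>W'\<in>committees k. thiele_score s A W \<ge> thiele_score s A W'}"
    unfolding thiele_rule_def by blast
  show "anonymous f \<and> neutral f \<and> consistent f \<and> continuous_rule f \<and> indep_losers f"
    using thiele_anonymous[where f = f, OF s] thiele_neutral[where f = f, OF s]
      thiele_consistent[where f = f, OF s] thiele_continuous[where f = f, OF s]
      thiele_indep_losers[where f = f, OF s] by blast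
next
  assume "anonymous f \<and> neutral f \<and> consistent f \<and> continuous_rule f \<and> indep_losers f"
  then interpret axiomatic_rule k f by unfold_locales (use assms in auto)
  show "thiele_rule k f" by (rule thiele)
qed

end
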